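(* Let $\Omega\subset\mathbf{R}^d$ be an open set with boundary $\Gamma$. For all $i,j\in\{1,\ldots,d\}$ let $a_{ij}\in L_\infty(\Omega,\mathbf{C})$, let $\theta\in[0,\frac\pi2)$ and suppose $\sum_{i,j=1}^d a_{ij}(x)\,\xi_i\,\overline{\xi_j}\in\Sigma_\theta$ for all $\xi\in\mathbf{C}^d$ and a.e. $x\in\Omega$. Let $\mu$ be a positive Borel measure on $\Gamma$ such that $\mu(K)<\infty$ for every compact $K\subset\Gamma$. Define the form $a$ by $D(a)=\{u\in H^1(\Omega)\cap C(\overline\Omega):\int_\Gamma|u|^2\,d\mu<\infty\}$ and $a(u,v)=\sum_{i,j=1}^d\int_\Omega(\partial_iu)\,a_{ij}\,\overline{\partial_jv}+\int_\Gamma u\,\overline v\,d\mu$. Suppose that the Neumann form $a_N$, given by $D(a_N)=H^1(\Omega)$ and $a_N(u,v)=\sum_{i,j=1}^d\int_\Omega(\partial_iu)\,a_{ij}\,\overline{\partial_jv}$, is closable. Then there exists a Borel set $\Gamma_{a,\mu}\subset\Gamma$ such that $$\{\varphi\in L_2(\Gamma,\mu):\varphi\text{ is a trace of }0\}=L_2(\Gamma\setminus\Gamma_{a,\mu},\mu).$$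
   Context: $\Sigma_\theta=\{re^{i\alpha}:r\ge0,\ |\alpha|\le\theta\}$. The closure $\overline{a_N}$ has domain $D(\overline{a_N})\subset L_2(\Omega)$, with norm $(\operatorname{Re}\overline{a_N}(u,u)+\|u\|_2^2)^{1/2}$. For $u\in D(\overline{a_N})$ and $\varphi\in L_2(\Gamma,\mu)$, $\varphi$ is a trace (or $(a,\mu)$-trace) of $u$ if there exist $u_1,u_2,\ldots\in D(a)$ with $u_n\to u$ in $D(\overline{a_N})$ and $u_n|_\Gamma\to\varphi$ in $L_2(\Gamma,\mu)$. $L_2(\Gamma\setminus\Gamma_{a,\mu},\mu)$ is regarded as the subspace of $L_2(\Gamma,\mu)$ of functions vanishing $\mu$-a.e. on $\Gamma_{a,\mu}$. *)

theory Defs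
  imports "HOL-Analysis.Analysis"
begin

text \<open>
  Elements of \<open>L\<^sub>2\<close> and \<open>L\<^sub>\<infinity>\<close> are represented by measurable functions, not by classes modulo
  null sets; two measurable functions that agree almost everywhere stand for the same element.
\<close>

definition L2 :: "'x measure \<Rightarrow> ('x \<Rightarrow> complex) set" where
  "L2 M = {u \<in> borel_measurable M. integrable M (\<lambda>x. (cmod (u x))\<^sup>2)}"

definition L2_norm :: "'x measure \<Rightarrow> ('x \<Rightarrow> complex) \<Rightarrow> real" where
  "L2_norm M u = sqrt (\<integral>x. (cmod (u x))\<^sup>2 \<partial>M)"

definition L_infinity :: "'x measure \<Rightarrow> ('x \<Rightarrow> complex) set" where
  "L_infinity M = {u \<in> borel_measurable M. \<exists>C. AE x in M. cmod (u x) \<le> C}"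

definition sector :: "real \<Rightarrow> complex set" where
  "sector \<theta> = {rcis r \<alpha> |r \<alpha>. 0 \<le> r \<and> \<bar>\<alpha>\<bar> \<le> \<theta>}"


subsection \<open>Weak derivatives and \<open>H\<^sup>1\<close>\<close>

definition partial_deriv :: "'d::finite \<Rightarrow> (real^'d \<Rightarrow> complex) \<Rightarrow> real^'d \<Rightarrow> complex" where
  "partial_deriv i f x = frechet_derivative f (at x) (axis i 1)"

fun iter_partial_deriv :: "'d::finite list \<Rightarrow> (real^'d \<Rightarrow> complex) \<Rightarrow> real^'d \<Rightarrow> complex" where
  "iter_partial_deriv [] f = f"
| "iter_partial_deriv (i # is) f = iter_partial_deriv is (partial_deriv i f)"

text \<open>The space \<open>C\<^sub>c\<^sup>\<infinity>(\<Omega>)\<close>, its elements being extended by zero to the whole space.\<close>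

definition test_functions :: "(real^'d::finite) set \<Rightarrow> (real^'d \<Rightarrow> complex) set" where
  "test_functions \<Omega> = {\<phi>. (\<forall>is. iter_partial_deriv is \<phi> differentiable_on UNIV)
      \<and> compact (closure {x. \<phi> x \<noteq> 0}) \<and> closure {x. \<phi> x \<noteq> 0} \<subseteq> \<Omega>}"

definition is_weak_deriv ::
    "(real^'d::finite) set \<Rightarrow> 'd \<Rightarrow> (real^'d \<Rightarrow> complex) \<Rightarrow> (real^'d \<Rightarrow> complex) \<Rightarrow> bool" where
  "is_weak_deriv \<Omega> i u g \<longleftrightarrow> (\<forall>\<phi>\<in>test_functions \<Omega>.
      (\<integral>x. u x * partial_deriv i \<phi> x \<partial>lebesgue_on \<Omega>) = - (\<integral>x. g x * \<phi> x \<partial>lebesgue_on \<Omega>))"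

definition H1 :: "(real^'d::finite) set \<Rightarrow> (real^'d \<Rightarrow> complex) set" where
  "H1 \<Omega> = {u \<in> L2 (lebesgue_on \<Omega>). \<forall>i. \<exists>g\<in>L2 (lebesgue_on \<Omega>). is_weak_deriv \<Omega> i u g}"

text \<open>The weak derivative is determined only almost everywhere; any representative will do.\<close>

definition weak_deriv ::
    "(real^'d::finite) set \<Rightarrow> 'd \<Rightarrow> (real^'d \<Rightarrow> complex) \<Rightarrow> real^'d \<Rightarrow> complex" where
  "weak_deriv \<Omega> i u = (SOME g. g \<in> L2 (lebesgue_on \<Omega>) \<and> is_weak_deriv \<Omega> i u g)"


subsection \<open>Sectorial forms in \<open>L\<^sub>2\<close> and their closure\<close>

record 'x form =
  form_dom :: "('x \<Rightarrow> complex) set"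
  form_val :: "('x \<Rightarrow> complex) \<Rightarrow> ('x \<Rightarrow> complex) \<Rightarrow> complex"

definition form_norm :: "'x measure \<Rightarrow> 'x form \<Rightarrow> ('x \<Rightarrow> complex) \<Rightarrow> real" where
  "form_norm M b u = sqrt (Re (form_val b u u) + (L2_norm M u)\<^sup>2)"

definition form_Cauchy :: "'x measure \<Rightarrow> 'x form \<Rightarrow> (nat \<Rightarrow> 'x \<Rightarrow> complex) \<Rightarrow> bool" where
  "form_Cauchy M b U \<longleftrightarrow> (\<forall>n. U n \<in> form_dom b) \<and>
     (\<forall>\<epsilon>>0. \<exists>N. \<forall>m\<ge>N. \<forall>n\<ge>N. form_norm M b (\<lambda>x. U m x - U n x) < \<epsilon>)"

text \<open>
  Closability says that the continuous extension of the inclusion of \<open>form_dom b\<close> into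
  \<open>L\<^sub>2\<close> to the completion of \<open>form_dom b\<close> is injective.
\<close>

definition closable :: "'x measure \<Rightarrow> 'x form \<Rightarrow> bool" where
  "closable M b \<longleftrightarrow> (\<forall>U. form_Cauchy M b U \<longrightarrow> (\<lambda>n. L2_norm M (U n)) \<longlonglongrightarrow> 0
     \<longrightarrow> (\<lambda>n. form_norm M b (U n)) \<longlonglongrightarrow> 0)"

definition form_approx ::
    "'x measure \<Rightarrow> 'x form \<Rightarrow> (nat \<Rightarrow> 'x \<Rightarrow> complex) \<Rightarrow> ('x \<Rightarrow> complex) \<Rightarrow> bool" where
  "form_approx M b U u \<longleftrightarrow> form_Cauchy M b U \<and> (\<lambda>n. L2_norm M (\<lambda>x. U n x - u x)) \<longlonglongrightarrow> 0"

text \<open>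
  Meaningful for closable sectorial forms only; then the limit exists and does not depend on the
  approximating sequences.
\<close>

definition form_closure :: "'x measure \<Rightarrow> 'x form \<Rightarrow> 'x form" where
  "form_closure M b =
     \<lparr> form_dom = {u \<in> L2 M. \<exists>U. form_approx M b U u},
       form_val = (\<lambda>u v. THE z. \<forall>U V. form_approx M b U u \<longrightarrow> form_approx M b V v
                      \<longrightarrow> (\<lambda>n. form_val b (U n) (V n)) \<longlonglongrightarrow> z) \<rparr>"


subsection \<open>The forms \<open>a\<^sub>N\<close> and \<open>a\<close>, and traces\<close>

definition neumann_form ::
    "(real^'d::finite) set \<Rightarrow> ('d \<Rightarrow> 'd \<Rightarrow> real^'d \<Rightarrow> complex) \<Rightarrow> (real^'d) form" where
  "neumann_form \<Omega> A =
     \<lparr> form_dom = H1 \<Omega>,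
       form_val = (\<lambda>u v. \<Sum>i\<in>UNIV. \<Sum>j\<in>UNIV.
          \<integral>x. weak_deriv \<Omega> i u x * A i j x * cnj (weak_deriv \<Omega> j v x) \<partial>lebesgue_on \<Omega>) \<rparr>"

text \<open>
  An element of \<open>H\<^sup>1(\<Omega>) \<inter> C(closure \<Omega>)\<close> is represented by its continuous representative on
  \<open>closure \<Omega>\<close>, which is unique. The measure \<open>\<mu>\<close> has the space \<open>frontier \<Omega>\<close>, so that integration
  with respect to \<open>\<mu>\<close> involves only the restriction to \<open>frontier \<Omega>\<close>.
\<close>

definition robin_form ::
    "(real^'d::finite) set \<Rightarrow> ('d \<Rightarrow> 'd \<Rightarrow> real^'d \<Rightarrow> complex) \<Rightarrow> (real^'d) measure
      \<Rightarrow> (real^'d) form" where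
  "robin_form \<Omega> A \<mu> =
     \<lparr> form_dom = {u \<in> H1 \<Omega>. continuous_on (closure \<Omega>) u
          \<and> (\<integral>\<^sup>+x. ennreal ((cmod (u x))\<^sup>2) \<partial>\<mu>) < \<infinity>},
       form_val = (\<lambda>u v. (\<Sum>i\<in>UNIV. \<Sum>j\<in>UNIV.
            \<integral>x. weak_deriv \<Omega> i u x * A i j x * cnj (weak_deriv \<Omega> j v x) \<partial>lebesgue_on \<Omega>)
          + (\<integral>x. u x * cnj (v x) \<partial>\<mu>)) \<rparr>"

definition is_trace ::
    "(real^'d::finite) set \<Rightarrow> ('d \<Rightarrow> 'd \<Rightarrow> real^'d \<Rightarrow> complex) \<Rightarrow> (real^'d) measure
      \<Rightarrow> (real^'d \<Rightarrow> complex) \<Rightarrow> (real^'d \<Rightarrow> complex) \<Rightarrow> bool" where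
  "is_trace \<Omega> A \<mu> \<phi> u \<longleftrightarrow>
     u \<in> form_dom (form_closure (lebesgue_on \<Omega>) (neumann_form \<Omega> A)) \<and> \<phi> \<in> L2 \<mu> \<and>
     (\<exists>U. (\<forall>n. U n \<in> form_dom (robin_form \<Omega> A \<mu>))
        \<and> (\<lambda>n. form_norm (lebesgue_on \<Omega>) (form_closure (lebesgue_on \<Omega>) (neumann_form \<Omega> A))
                 (\<lambda>x. U n x - u x)) \<longlonglongrightarrow> 0
        \<and> (\<lambda>n. L2_norm \<mu> (\<lambda>x. U n x - \<phi> x)) \<longlonglongrightarrow> 0)"

end

theory Submission
  imports Defs
begin

text \<open>
  The traces of \<open>0\<close> form a closed subspace \<open>F\<close> of \<open>L\<^sub>2(\<mu>)\<close>. If \<open>u\<^sub>n \<rightarrow> 0\<close> in the form norm and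
  \<open>u\<^sub>n \<rightarrow> \<phi>\<close> in \<open>L\<^sub>2(\<mu>)\<close>, then for \<open>\<psi> \<in> C\<^sub>c\<^sup>\<infinity>\<close> the product rule
  \<open>\<nabla>(\<psi> u\<^sub>n) = \<psi> \<nabla>u\<^sub>n + u\<^sub>n \<nabla>\<psi>\<close> and the positivity of the real part of the form give \<open>\<psi> u\<^sub>n \<rightarrow> 0\<close> in
  the form norm, so \<open>\<psi> \<phi> \<in> F\<close>. Approximating indicators of boxes by such \<open>\<psi>\<close>, one sees that \<open>F\<close> is
  invariant under multiplication by indicators of Borel sets. A closed subspace of \<open>L\<^sub>2\<close> of a
  \<open>\<sigma>\<close>-finite measure with this property consists of all functions vanishing off a fixed set, its
  essential support. Since weak derivatives are chosen arbitrarily, their uniqueness almost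
  everywhere is needed throughout; it follows by testing against the same bump functions.
\<close>

subsection \<open>Square-integrable functions\<close>

text \<open>The product rule is therefore estimated inside the form. For \<psi> grad u, the real
  part of the quadratic form at a point is nonnegative and gets multiplied by |\<psi>|^2, so only
  the supremum of |\<psi>| enters; for u grad \<psi>, the boundedness of the coefficients leaves the
  L2 norm of u. Neither part is a gradient in general, which is why the form is studied on tuples of
  L2 functions. The norm of the closure is only evaluated on \<open>H1\<close>, where the
  approximating functions and their limit 0 already lie; closability identifies it there with the
  original norm. Convergence is measured by squared norms, with the bound 2|x|^2 + 2|y|^2 for |x +
  y|^2 in place of the triangle inequality. The sector hypothesis gives one null set for each vector
  \<xi>, whereas inserting the gradient at a point for \<xi> takes one null set for all \<xi>;
  density and continuity bridge the gap.\<close>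

lemma cmod_add_squared_le: "(cmod (x + y))\<^sup>2 \<le> 2 * (cmod x)\<^sup>2 + 2 * (cmod y)\<^sup>2"
proof -
  have "(cmod (x + y))\<^sup>2 \<le> (cmod x + cmod y)\<^sup>2"
    by (simp add: power_mono norm_triangle_ineq)
  also have "\<dots> \<le> 2 * (cmod x)\<^sup>2 + 2 * (cmod y)\<^sup>2"
    using sum_squares_bound[of "cmod x" "cmod y"] by (simp add: power2_sum)
  finally show ?thesis .
qed

lemma L2_measurable [measurable_dest]: "u \<in> L2 M \<Longrightarrow> u \<in> borel_measurable M"
  by (simp add: L2_def)

lemma L2_integrable: "u \<in> L2 M \<Longrightarrow> integrable M (\<lambda>x. (cmod (u x))\<^sup>2)"
  by (simp add: L2_def)

lemma L2_norm_squared: "(L2_norm M u)\<^sup>2 = (\<integral>x. (cmod (u x))\<^sup>2 \<partial>M)"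
  by (simp add: L2_norm_def)

lemma L2_dominated:
  assumes [measurable]: "f \<in> borel_measurable M"
    and "w \<in> L2 M" "AE x in M. cmod (f x) \<le> C * cmod (w x)"
  shows "f \<in> L2 M"
proof -
  have "integrable M (\<lambda>x. (cmod (f x))\<^sup>2)"
  proof (rule Bochner_Integration.integrable_bound)
    show "integrable M (\<lambda>x. C\<^sup>2 * (cmod (w x))\<^sup>2)"
      using L2_integrable[OF assms(2)] by simp
    show "AE x in M. norm ((cmod (f x))\<^sup>2) \<le> norm (C\<^sup>2 * (cmod (w x))\<^sup>2)"
      using assms(3)
    proof eventually_elim
      case (elim x)
      then have "(cmod (f x))\<^sup>2 \<le> (C * cmod (w x))\<^sup>2"
        by (intro power_mono) auto
      then show ?case by (simp add: power_mult_distrib)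
    qed
  qed measurable
  then show ?thesis by (simp add: L2_def)
qed

lemma L2_zero [simp]: "(\<lambda>x. 0) \<in> L2 M"
  by (simp add: L2_def)

lemma L2_mult_bounded:
  assumes "u \<in> L2 M" "f \<in> borel_measurable M" "AE x in M. cmod (f x) \<le> C"
  shows "(\<lambda>x. f x * u x) \<in> L2 M"
proof (rule L2_dominated)
  show "AE x in M. cmod (f x * u x) \<le> C * cmod (u x)"
    using assms(3) by eventually_elim (simp add: norm_mult mult_right_mono)
qed (use assms in \<open>auto intro!: borel_measurable_times dest: L2_measurable\<close>)

lemma L2_cmult: "u \<in> L2 M \<Longrightarrow> (\<lambda>x. c * u x) \<in> L2 M"
  by (rule L2_mult_bounded[where C = "cmod c"]) auto

lemma L2_indicator_mult:
  assumes "u \<in> L2 M" "B \<in> sets M"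
  shows "(\<lambda>x. indicator B x * u x) \<in> L2 M"
  by (rule L2_mult_bounded[where C = 1]) (use assms in \<open>auto simp: indicator_def\<close>)

lemma L2_add:
  assumes "u \<in> L2 M" "v \<in> L2 M" shows "(\<lambda>x. u x + v x) \<in> L2 M"
proof -
  note [measurable] = L2_measurable[OF assms(1)] L2_measurable[OF assms(2)]
  have "integrable M (\<lambda>x. (cmod (u x + v x))\<^sup>2)"
  proof (rule Bochner_Integration.integrable_bound)
    show "integrable M (\<lambda>x. 2 * (cmod (u x))\<^sup>2 + 2 * (cmod (v x))\<^sup>2)"
      using assms by (auto intro!: L2_integrable)
    show "AE x in M. norm ((cmod (u x + v x))\<^sup>2) \<le> norm (2 * (cmod (u x))\<^sup>2 + 2 * (cmod (v x))\<^sup>2)"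
      by (rule AE_I2) (use cmod_add_squared_le in auto)
  qed measurable
  then show ?thesis by (simp add: L2_def)
qed

lemma L2_diff:
  assumes "u \<in> L2 M" "v \<in> L2 M" shows "(\<lambda>x. u x - v x) \<in> L2 M"
  using L2_add[OF assms(1) L2_cmult[OF assms(2), of "-1"]] by simp

lemma integrable_mult_L2:
  assumes "u \<in> L2 M" "v \<in> L2 M" shows "integrable M (\<lambda>x. u x * v x)"
proof (rule Bochner_Integration.integrable_bound)
  show "integrable M (\<lambda>x. (cmod (u x))\<^sup>2 + (cmod (v x))\<^sup>2)"
    using assms by (auto intro!: L2_integrable)
  show "AE x in M. norm (u x * v x) \<le> norm ((cmod (u x))\<^sup>2 + (cmod (v x))\<^sup>2)"
  proof (rule AE_I2)
    fix x
    have "2 * (cmod (u x) * cmod (v x)) \<le> (cmod (u x))\<^sup>2 + (cmod (v x))\<^sup>2"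
      using sum_squares_bound[of "cmod (u x)" "cmod (v x)"] by simp
    moreover have "0 \<le> cmod (u x) * cmod (v x)" by simp
    ultimately have "cmod (u x) * cmod (v x) \<le> (cmod (u x))\<^sup>2 + (cmod (v x))\<^sup>2"
      by linarith
    then show "norm (u x * v x) \<le> norm ((cmod (u x))\<^sup>2 + (cmod (v x))\<^sup>2)"
      by (simp add: norm_mult)
  qed
qed (use assms in \<open>auto intro!: borel_measurable_times dest: L2_measurable\<close>)

lemma integral_cmod_add_squared_le:
  assumes "u \<in> L2 M" "v \<in> L2 M"
  shows "(\<integral>x. (cmod (u x + v x))\<^sup>2 \<partial>M)
    \<le> 2 * (\<integral>x. (cmod (u x))\<^sup>2 \<partial>M) + 2 * (\<integral>x. (cmod (v x))\<^sup>2 \<partial>M)"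
proof -
  have "(\<integral>x. (cmod (u x + v x))\<^sup>2 \<partial>M)
      \<le> (\<integral>x. 2 * (cmod (u x))\<^sup>2 + 2 * (cmod (v x))\<^sup>2 \<partial>M)"
    using assms by (intro integral_mono) (auto intro!: L2_integrable L2_add cmod_add_squared_le)
  also have "\<dots> = 2 * (\<integral>x. (cmod (u x))\<^sup>2 \<partial>M) + 2 * (\<integral>x. (cmod (v x))\<^sup>2 \<partial>M)"
    using assms by (simp add: L2_integrable)
  finally show ?thesis .
qed

lemma integral_cmod_mult_squared_le:
  assumes "u \<in> L2 M" "f \<in> borel_measurable M" "AE x in M. cmod (f x) \<le> C"
  shows "(\<integral>x. (cmod (f x * u x))\<^sup>2 \<partial>M) \<le> C\<^sup>2 * (\<integral>x. (cmod (u x))\<^sup>2 \<partial>M)"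
proof -
  have "(\<integral>x. (cmod (f x * u x))\<^sup>2 \<partial>M) \<le> (\<integral>x. C\<^sup>2 * (cmod (u x))\<^sup>2 \<partial>M)"
  proof (rule integral_mono_AE)
    show "AE x in M. (cmod (f x * u x))\<^sup>2 \<le> C\<^sup>2 * (cmod (u x))\<^sup>2"
      using assms(3)
      by eventually_elim (simp add: norm_mult power_mult_distrib mult_right_mono power_mono)
  qed (use assms L2_mult_bounded[OF assms] in \<open>auto intro: L2_integrable\<close>)
  then show ?thesis by simp
qed

lemma L2_dominated_convergence:
  assumes f [measurable]: "\<And>n. f n \<in> borel_measurable M" and g [measurable]: "g \<in> borel_measurable M"
    and w: "w \<in> L2 M"
    and dom: "\<And>n. AE x in M. cmod (f n x) \<le> C * cmod (w x)"
    and lim: "AE x in M. (\<lambda>n. f n x) \<longlonglongrightarrow> g x"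
  shows "g \<in> L2 M" "(\<lambda>n. \<integral>x. (cmod (f n x - g x))\<^sup>2 \<partial>M) \<longlonglongrightarrow> 0"
proof -
  have dom': "AE x in M. \<forall>n. cmod (f n x) \<le> C * cmod (w x)"
    using dom by (simp add: AE_all_countable)
  have gdom: "AE x in M. cmod (g x) \<le> C * cmod (w x)"
    using dom' lim
  proof eventually_elim
    case (elim x)
    then have "(\<lambda>n. cmod (f n x)) \<longlonglongrightarrow> cmod (g x)" by (intro tendsto_norm)
    then show ?case using elim(1) by (intro LIMSEQ_le_const2) auto
  qed
  show "g \<in> L2 M" by (rule L2_dominated[OF g w gdom])
  have "(\<lambda>n. \<integral>x. (cmod (f n x - g x))\<^sup>2 \<partial>M) \<longlonglongrightarrow> (\<integral>x. 0 \<partial>M)"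
  proof (rule integral_dominated_convergence)
    \<comment> \<open>In the limit \<open>g\<close> inherits the bound C |w| of the
      \<open>f n\<close>, so the difference is at most 2 C |w|.\<close>
    show "integrable M (\<lambda>x. 4 * C\<^sup>2 * (cmod (w x))\<^sup>2)"
      using L2_integrable[OF w] by simp
    show "AE x in M. (\<lambda>n. (cmod (f n x - g x))\<^sup>2) \<longlonglongrightarrow> 0"
      using lim
    proof eventually_elim
      case (elim x)
      then have "(\<lambda>n. (cmod (f n x - g x))\<^sup>2) \<longlonglongrightarrow> (cmod (g x - g x))\<^sup>2"
        by (intro tendsto_intros)
      then show ?case by simp
    qed
    fix n show "AE x in M. norm ((cmod (f n x - g x))\<^sup>2) \<le> 4 * C\<^sup>2 * (cmod (w x))\<^sup>2"
      using dom' gdom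
    proof eventually_elim
      case (elim x)
      then have "cmod (f n x - g x) \<le> 2 * (C * cmod (w x))"
        using norm_triangle_ineq4[of "f n x" "g x"] by (smt (verit))
      then have "(cmod (f n x - g x))\<^sup>2 \<le> (2 * (C * cmod (w x)))\<^sup>2"
        by (intro power_mono) auto
      then show ?case by (simp add: power_mult_distrib)
    qed
  qed measurable
  then show "(\<lambda>n. \<integral>x. (cmod (f n x - g x))\<^sup>2 \<partial>M) \<longlonglongrightarrow> 0" by simp
qed


subsection \<open>Closed subspaces of \<open>L\<^sub>2\<close> invariant under restriction to measurable sets\<close>

lemma LIMSEQ_indicator_partial_Union:
  fixes B :: "nat \<Rightarrow> 'a set"
  shows "(\<lambda>n. indicator (\<Union>k<n. B k) x) \<longlonglongrightarrow> (indicator (\<Union>n. B n) x :: complex)"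
proof -
  have "incseq (\<lambda>n. \<Union>k<n. B k)" by (force simp: incseq_def)
  moreover have "(\<Union>n. \<Union>k<n. B k) = (\<Union>n. B n)" by auto
  ultimately show ?thesis using LIMSEQ_indicator_incseq[of "\<lambda>n. \<Union>k<n. B k" x] by simp
qed

text \<open>Closedness is phrased by squared distances to single elements instead of sequences, the
  shape in which it is verified for traces of zero. As functions stand for classes, it also makes
  \<open>F\<close> insensitive to changes on null sets.\<close>

locale L2_closed_subspace =
  fixes M :: "'x measure" and F :: "('x \<Rightarrow> complex) set"
  assumes subset: "F \<subseteq> L2 M"
    and zero: "(\<lambda>x. 0) \<in> F"
    and add: "f \<in> F \<Longrightarrow> g \<in> F \<Longrightarrow> (\<lambda>x. f x + g x) \<in> F"
    and cmult: "f \<in> F \<Longrightarrow> (\<lambda>x. c * f x) \<in> F"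
    and closed: "g \<in> L2 M \<Longrightarrow> (\<And>e. 0 < e \<Longrightarrow> \<exists>f\<in>F. (\<integral>x. (cmod (f x - g x))\<^sup>2 \<partial>M) < e) \<Longrightarrow> g \<in> F"
begin

text \<open>The only way in which closedness is used below: every limit taken in \<open>F\<close> is
  a pointwise limit a.e. under a square-integrable majorant.\<close>

lemma closed_dominated:
  assumes "\<And>n. f n \<in> F" "g \<in> borel_measurable M" "w \<in> L2 M"
    "\<And>n. AE x in M. cmod (f n x) \<le> C * cmod (w x)"
    "AE x in M. (\<lambda>n. f n x) \<longlonglongrightarrow> g x"
  shows "g \<in> F"
proof (rule closed)
  have f: "f n \<in> borel_measurable M" for n
    using assms(1) subset by (auto dest: L2_measurable)
  note conv = L2_dominated_convergence[OF f assms(2-5)]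
  show "g \<in> L2 M" by (rule conv)
  fix e :: real assume "0 < e"
  then have "eventually (\<lambda>n. (\<integral>x. (cmod (f n x - g x))\<^sup>2 \<partial>M) < e) sequentially"
    using order_tendstoD(2)[OF conv(2)] by blast
  then show "\<exists>f\<in>F. (\<integral>x. (cmod (f x - g x))\<^sup>2 \<partial>M) < e"
    using assms(1) by (auto simp: eventually_sequentially)
qed

text \<open>The constant sequence \<open>f\<close> converges a.e. to any other representative
  \<open>g\<close>.\<close>

lemma AE_cong:
  assumes "f \<in> F" "g \<in> borel_measurable M" "AE x in M. f x = g x"
  shows "g \<in> F"
proof (rule closed_dominated[where f = "\<lambda>_. f" and w = f and C = 1])
  show "AE x in M. (\<lambda>n. f x) \<longlonglongrightarrow> g x"
    using assms(3) by eventually_elim simp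
qed (use assms subset in auto)

lemma sum: "finite I \<Longrightarrow> (\<And>i. i \<in> I \<Longrightarrow> f i \<in> F) \<Longrightarrow> (\<lambda>x. \<Sum>i\<in>I. f i x) \<in> F"
proof (induction I rule: finite_induct)
  case empty
  then show ?case by (simp add: zero)
next
  case (insert i I)
  then show ?case using add[of "f i" "\<lambda>x. \<Sum>i\<in>I. f i x"] by simp
qed

text \<open>The sets whose indicators act on \<open>F\<close> form a \<sigma>-algebra, so generators
  suffice. The \<sigma>-algebra is taken on the whole type although \<open>M\<close> may live on a
  smaller space; the second assumption bridges the two.\<close>

lemma indicator_sigma_sets:
  assumes "G \<subseteq> Pow UNIV"
    and meas: "\<And>B. B \<in> sigma_sets UNIV G \<Longrightarrow> B \<inter> space M \<in> sets M"
    and basic: "\<And>B f. B \<in> G \<Longrightarrow> f \<in> F \<Longrightarrow> (\<lambda>x. indicator B x * f x) \<in> F"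
    and "B \<in> sigma_sets UNIV G" "f \<in> F"
  shows "(\<lambda>x. indicator B x * f x) \<in> F"
  using assms(4,5)
proof (induction arbitrary: f rule: sigma_sets.induct)
  case (Basic B)
  then show ?case by (rule basic)
next
  case Empty
  then show ?case by (simp add: zero)
next
  case (Compl B)
  have "(\<lambda>x. f x + (- 1) * (indicator B x * f x)) \<in> F"
    using Compl by (intro add cmult)
  also have "(\<lambda>x. f x + (- 1) * (indicator B x * f x)) = (\<lambda>x. indicator (UNIV - B) x * f x)"
    by (auto simp: indicator_def fun_eq_iff)
  finally show ?case .
next
  case (Union B)
  have fin: "(\<lambda>x. indicator (\<Union>k<n. B k) x * f x) \<in> F" for n
  proof (induction n)
    case 0
    then show ?case by (simp add: zero)
  next
    case (Suc n)
    \<comment> \<open>Inclusion-exclusion for two sets. The hypothesis for \<open>B n\<close> is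
      applied to \<open>f\<close> and also to \<open>f\<close> cut off to the earlier sets, hence
      the induction for arbitrary \<open>f\<close>.\<close>
    have "(\<lambda>x. indicator (\<Union>k<n. B k) x * f x
        + (indicator (B n) x * f x + (- 1) * (indicator (B n) x * (indicator (\<Union>k<n. B k) x * f x)))) \<in> F"
      using Suc Union by (intro add cmult)
    also have "(\<lambda>x. indicator (\<Union>k<n. B k) x * f x
        + (indicator (B n) x * f x + (- 1) * (indicator (B n) x * (indicator (\<Union>k<n. B k) x * f x))))
        = (\<lambda>x. indicator (\<Union>k<Suc n. B k) x * f x)"
      by (auto simp: indicator_def fun_eq_iff less_Suc_eq)
    finally show ?case .
  qed
  have "(\<Union>n. B n) \<inter> space M \<in> sets M" using Union(1) by (intro meas sigma_sets.Union)
  then have "(\<lambda>x. indicator (\<Union>n. B n) x * f x) \<in> borel_measurable M"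
    using \<open>f \<in> F\<close> subset
    by (intro borel_measurable_times) (auto simp: borel_measurable_indicator_iff dest: L2_measurable)
  then show ?case
  proof (rule closed_dominated[where w = f and C = 1, OF fin])
    show "AE x in M. (\<lambda>n. indicator (\<Union>k<n. B k) x * f x) \<longlonglongrightarrow> indicator (\<Union>n. B n) x * f x"
      by (intro AE_I2 tendsto_intros LIMSEQ_indicator_partial_Union)
  qed (use \<open>f \<in> F\<close> subset in \<open>auto simp: indicator_def\<close>)
qed

end

section \<open>Closed ideals and their essential support\<close>

locale L2_closed_ideal = sigma_finite_measure M + L2_closed_subspace M F
  for M :: "'x measure" and F +
  assumes indicator: "B \<in> sets M \<Longrightarrow> f \<in> F \<Longrightarrow> (\<lambda>x. indicator B x * f x) \<in> F"
begin

lemma simple_mult: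
  assumes "simple_function M s" "f \<in> F"
  shows "(\<lambda>x. s x * f x) \<in> F"
\<comment> \<open>The sum over the values of \<open>s\<close> picks out the right term only at
  points of \<open>space M\<close>, so it equals the product there but possibly not
  elsewhere.\<close>
proof (rule AE_cong)
  let ?g = "\<lambda>x. \<Sum>y\<in>s ` space M. y * (indicator (s -` {y} \<inter> space M) x * f x)"
  show "?g \<in> F"
    using assms by (intro sum cmult indicator) (auto simp: simple_function_def)
  show "(\<lambda>x. s x * f x) \<in> borel_measurable M"
    using borel_measurable_simple_function[OF assms(1)] assms(2) subset
    by (auto intro!: borel_measurable_times dest: L2_measurable)
  show "AE x in M. ?g x = s x * f x"
  proof (rule AE_I2)
    fix x assume x: "x \<in> space M"
    have fin: "finite (s ` space M)" using assms(1) by (simp add: simple_function_def)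
    have "?g x = (\<Sum>y\<in>s ` space M. if y = s x then y * f x else 0)"
      using x by (intro sum.cong) (auto simp: indicator_def)
    also have "\<dots> = s x * f x" using fin x by (simp add: sum.delta)
    finally show "?g x = s x * f x" .
  qed
qed

text \<open>On the set where \<open>f\<close> does not vanish, g = (g / f) f. The quotient need not
  be bounded, but simple functions approximate it with modulus at most 2 |g / f|, so their products
  with \<open>f\<close> stay below 2 |g|. Where \<open>f\<close> vanishes, so do all these
  products.\<close>

lemma restrict_to_support:
  assumes "f \<in> F" "g \<in> L2 M"
  shows "(\<lambda>x. indicator {x \<in> space M. f x \<noteq> 0} x * g x) \<in> F"
proof -
  have [measurable]: "f \<in> borel_measurable M" "g \<in> borel_measurable M"
    using assms subset by (auto dest: L2_measurable)
  have "(\<lambda>x. g x / f x) \<in> borel_measurable M" by measurable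
  from borel_measurable_implies_sequence_metric[OF this, of 0]
  obtain s where s: "\<And>i. simple_function M (s i)"
      "\<And>x. x \<in> space M \<Longrightarrow> (\<lambda>i. s i x) \<longlonglongrightarrow> g x / f x"
      "\<And>i x. x \<in> space M \<Longrightarrow> dist (s i x) 0 \<le> 2 * dist (g x / f x) 0"
    by blast
  show ?thesis
  proof (rule closed_dominated)
    show "(\<lambda>x. s n x * f x) \<in> F" for n by (rule simple_mult[OF s(1) assms(1)])
    show "AE x in M. cmod (s n x * f x) \<le> 2 * cmod (g x)" for n
    proof (rule AE_I2)
      fix x assume x: "x \<in> space M"
      have "cmod (s n x) * cmod (f x) \<le> 2 * cmod (g x / f x) * cmod (f x)"
        using s(3)[OF x] by (intro mult_right_mono) (auto simp: dist_norm)
      also have "\<dots> \<le> 2 * cmod (g x)" by (simp add: norm_divide)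
      finally show "cmod (s n x * f x) \<le> 2 * cmod (g x)" by (simp add: norm_mult)
    qed
    show "AE x in M. (\<lambda>n. s n x * f x) \<longlonglongrightarrow> indicator {x \<in> space M. f x \<noteq> 0} x * g x"
    proof (rule AE_I2)
      fix x assume x: "x \<in> space M"
      have "(\<lambda>n. s n x * f x) \<longlonglongrightarrow> g x / f x * f x"
        using s(2)[OF x] by (intro tendsto_intros)
      moreover have "g x / f x * f x = indicator {x \<in> space M. f x \<noteq> 0} x * g x"
        using x by (auto simp: indicator_def)
      ultimately show "(\<lambda>n. s n x * f x) \<longlonglongrightarrow> indicator {x \<in> space M. f x \<noteq> 0} x * g x"
        by simp
    qed
  qed (use assms in measurable)
qed

text \<open>The sets on which \<open>F\<close> contains all of L2. By
  \<open>restrict_to_support\<close> the nonvanishing set of each element of \<open>F\<close> is one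
  of them.\<close>

definition full_sets :: "'x set set" where
  "full_sets = {B \<in> sets M. \<forall>g\<in>L2 M. (\<lambda>x. indicator B x * g x) \<in> F}"

lemma full_sets_Un:
  assumes "A \<in> full_sets" "B \<in> full_sets"
  shows "A \<union> B \<in> full_sets"
proof -
  have "(\<lambda>x. indicator (A \<union> B) x * g x) \<in> F" if g: "g \<in> L2 M" for g
  proof -
    \<comment> \<open>Removing \<open>A\<close> from \<open>g\<close> before applying fullness of
      \<open>B\<close> prevents the overlap from being counted twice.\<close>
    have "(\<lambda>x. indicator (space M - A) x * g x) \<in> L2 M"
      using assms g by (intro L2_indicator_mult) (auto simp: full_sets_def)
    then have "(\<lambda>x. indicator A x * g x + indicator B x * (indicator (space M - A) x * g x)) \<in> F"
      using assms g by (intro add) (auto simp: full_sets_def)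
    also have "(\<lambda>x. indicator A x * g x + indicator B x * (indicator (space M - A) x * g x))
        = (\<lambda>x. indicator (A \<union> B) x * g x)"
      using assms sets.sets_into_space[of B M] by (auto simp: full_sets_def indicator_def fun_eq_iff)
    finally show ?thesis .
  qed
  then show ?thesis using assms by (auto simp: full_sets_def)
qed

lemma full_sets_UN:
  fixes B :: "nat \<Rightarrow> 'x set"
  assumes "\<And>n. B n \<in> full_sets"
  shows "(\<Union>n. B n) \<in> full_sets"
proof -
  have B: "B n \<in> sets M" for n using assms by (auto simp: full_sets_def)
  have C: "(\<Union>k<n. B k) \<in> full_sets" for n
  proof (induction n)
    case 0
    then show ?case by (simp add: full_sets_def zero)
  next
    case (Suc n)
    then show ?case using full_sets_Un[OF assms[of n] Suc] by (simp add: lessThan_Suc)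
  qed
  have "(\<lambda>x. indicator (\<Union>n. B n) x * g x) \<in> F" if g: "g \<in> L2 M" for g
  proof (rule closed_dominated[where w = g and C = 1])
    show "(\<lambda>x. indicator (\<Union>k<n. B k) x * g x) \<in> F" for n
      using C g by (auto simp: full_sets_def)
    show "(\<lambda>x. indicator (\<Union>n. B n) x * g x) \<in> borel_measurable M"
      using B g by (intro borel_measurable_times borel_measurable_indicator)
        (auto dest: L2_measurable)
    show "AE x in M. (\<lambda>n. indicator (\<Union>k<n. B k) x * g x) \<longlonglongrightarrow> indicator (\<Union>n. B n) x * g x"
      by (intro AE_I2 tendsto_intros LIMSEQ_indicator_partial_Union)
  qed (use g in \<open>auto simp: indicator_def\<close>)
  then show ?thesis using B by (auto simp: full_sets_def)
qed

text \<open>The exceptional set is the complement of a full set that is maximal with respect to an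
  equivalent finite measure.\<close>

theorem eq_vanishing_off:
  "\<exists>B\<in>sets M. F = {f \<in> L2 M. AE x in M. x \<notin> B \<longrightarrow> f x = 0}"
proof -
  \<comment> \<open>This is where \<sigma>-finiteness enters: an everywhere positive
    \<open>h\<close> with finite integral yields a finite measure with the same null sets as
    \<open>M\<close>.\<close>
  obtain h where h [measurable]: "h \<in> borel_measurable M" and hfin: "integral\<^sup>N M h \<noteq> \<infinity>"
    and hpos: "\<And>x. x \<in> space M \<Longrightarrow> 0 < h x \<and> h x < \<infinity>"
    using Ex_finite_integrable_function by blast
  define \<nu> where "\<nu> = density M h"
  have \<nu>fin: "emeasure \<nu> A \<noteq> \<infinity>" for A
  proof -
    have "emeasure \<nu> A \<le> emeasure \<nu> (space \<nu>)" by (rule emeasure_space)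
    also have "\<dots> = integral\<^sup>N M h"
      unfolding \<nu>_def by (simp add: emeasure_density cong: nn_integral_cong)
    finally show ?thesis using hfin by (auto simp: top_unique)
  qed
  have "{} \<in> full_sets" by (auto simp: full_sets_def zero)
  then have "full_sets \<noteq> {}" by auto
  then obtain m :: "nat \<Rightarrow> ennreal" where m: "range m \<subseteq> emeasure \<nu> ` full_sets"
      "(SUP A\<in>full_sets. emeasure \<nu> A) = (SUP i. m i)"
    using ennreal_SUP_countable_SUP by metis
  then have "\<forall>n. \<exists>A. A \<in> full_sets \<and> m n = emeasure \<nu> A" by blast
  then obtain A where A: "\<And>n. A n \<in> full_sets" "\<And>n. m n = emeasure \<nu> (A n)"
    by metis
  define B where "B = (\<Union>n. A n)"
  have B: "B \<in> full_sets" unfolding B_def by (rule full_sets_UN[OF A(1)])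
  then have [measurable]: "B \<in> sets M" by (simp add: full_sets_def)
  have max: "emeasure \<nu> C \<le> emeasure \<nu> B" if "C \<in> full_sets" for C
  proof -
    have "emeasure \<nu> C \<le> (SUP A\<in>full_sets. emeasure \<nu> A)" by (rule SUP_upper[OF that])
    also have "\<dots> = (SUP n. emeasure \<nu> (A n))" using m(2) A(2) by simp
    also have "\<dots> \<le> emeasure \<nu> B"
      using \<open>B \<in> sets M\<close> by (intro SUP_least emeasure_mono) (auto simp: B_def \<nu>_def)
    finally show ?thesis .
  qed
  have "F = {f \<in> L2 M. AE x in M. x \<notin> B \<longrightarrow> f x = 0}"
  proof (intro equalityI subsetI)
    fix f assume f: "f \<in> F"
    define S where "S = {x \<in> space M. f x \<noteq> 0}"
    have [measurable]: "f \<in> borel_measurable M" using f subset by (auto dest: L2_measurable)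
    have Sm [measurable]: "S \<in> sets M" unfolding S_def by measurable
    have "S \<in> full_sets"
      using restrict_to_support[OF f] Sm by (auto simp: full_sets_def S_def)
    \<comment> \<open>Joining \<open>S\<close> to \<open>B\<close> gives a full set again, so it
      cannot gain measure; since \<nu> is finite, the measure of \<open>B\<close> cancels and S - B
      is null.\<close>
    then have "emeasure \<nu> (B \<union> S) \<le> emeasure \<nu> B"
      using B by (intro max full_sets_Un)
    moreover have "emeasure \<nu> (B \<union> S) = emeasure \<nu> B + emeasure \<nu> (S - B)"
      by (subst plus_emeasure) (auto simp: \<nu>_def intro!: arg_cong[where f = "emeasure _"])
    ultimately have "emeasure \<nu> (S - B) = 0"
      using \<nu>fin[of B] by (metis ennreal_add_left_cancel_le add_0_right le_zero_eq infinity_ennreal_def)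
    then have "S - B \<in> null_sets \<nu>" by (auto simp: \<nu>_def null_sets_def)
    then have "AE x in M. x \<in> S - B \<longrightarrow> h x = 0"
      unfolding \<nu>_def using null_sets_density_iff[OF h] by blast
    then have "AE x in M. x \<notin> B \<longrightarrow> f x = 0"
    proof (rule AE_mp, intro AE_I2 impI)
      fix x assume "x \<in> space M" "x \<in> S - B \<longrightarrow> h x = 0" "x \<notin> B"
      then show "f x = 0" using hpos[of x] by (auto simp: S_def)
    qed
    then show "f \<in> {f \<in> L2 M. AE x in M. x \<notin> B \<longrightarrow> f x = 0}" using f subset by auto
  next
    fix f assume f: "f \<in> {f \<in> L2 M. AE x in M. x \<notin> B \<longrightarrow> f x = 0}"
    show "f \<in> F"
    proof (rule AE_cong)
      show "(\<lambda>x. indicator B x * f x) \<in> F" using f B by (auto simp: full_sets_def)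
      have "AE x in M. x \<notin> B \<longrightarrow> f x = 0" using f by simp
      then show "AE x in M. indicator B x * f x = f x"
        by eventually_elim (auto simp: indicator_def)
    qed (use f in \<open>auto dest: L2_measurable\<close>)
  qed
  then show ?thesis using \<open>B \<in> sets M\<close> by blast
qed

end


subsection \<open>Smooth functions\<close>

definition smooth_functions :: "(real^'d::finite \<Rightarrow> complex) set" where
  "smooth_functions = {f. \<forall>is. iter_partial_deriv is f differentiable_on UNIV}"

text \<open>Smooth functions are the largest class of differentiable functions that is closed under
  partial derivatives, so any class with these properties consists of smooth functions.\<close>

lemma smooth_functions_coinduct:
  assumes "f \<in> C" and "\<And>f. f \<in> C \<Longrightarrow> f differentiable_on UNIV"
    and "\<And>f i. f \<in> C \<Longrightarrow> partial_deriv i f \<in> C"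
  shows "f \<in> smooth_functions"
proof -
  have "iter_partial_deriv is f \<in> C" for "is"
    using assms(1) by (induction "is" arbitrary: f) (auto intro: assms(3))
  then show ?thesis using assms(2) by (auto simp: smooth_functions_def)
qed

lemma smooth_differentiable: "f \<in> smooth_functions \<Longrightarrow> f differentiable (at x)"
  by (auto simp: smooth_functions_def differentiable_on_eq_differentiable_at
      dest!: spec[where x = "[]"])

lemma smooth_continuous_on: "f \<in> smooth_functions \<Longrightarrow> continuous_on S f"
  using smooth_differentiable differentiable_imp_continuous_within
  by (metis continuous_at_imp_continuous_on)

lemma smooth_partial_deriv: "f \<in> smooth_functions \<Longrightarrow> partial_deriv i f \<in> smooth_functions"
  unfolding smooth_functions_def by (auto dest: spec[where x = "i # is" for "is"])

lemma smooth_borel_measurable: "f \<in> smooth_functions \<Longrightarrow> f \<in> borel_measurable borel"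
  by (intro borel_measurable_continuous_onI smooth_continuous_on)

lemma partial_deriv_eq: "(f has_derivative f') (at x) \<Longrightarrow> partial_deriv i f x = f' (axis i 1)"
  using frechet_derivative_at by (metis partial_deriv_def)

lemma partial_deriv_const: "partial_deriv i (\<lambda>x. c) = (\<lambda>x. 0)"
  by (rule ext, rule partial_deriv_eq[where f' = "\<lambda>_. 0"]) simp

lemma partial_deriv_add:
  assumes "\<And>x. f differentiable (at x)" "\<And>x. g differentiable (at x)"
  shows "partial_deriv i (\<lambda>x. f x + g x) = (\<lambda>x. partial_deriv i f x + partial_deriv i g x)"
proof
  fix x
  have "(f has_derivative frechet_derivative f (at x)) (at x)"
      "(g has_derivative frechet_derivative g (at x)) (at x)"
    using assms by (auto simp: frechet_derivative_works[symmetric])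
  from partial_deriv_eq[OF has_derivative_add[OF this]]
  show "partial_deriv i (\<lambda>x. f x + g x) x = partial_deriv i f x + partial_deriv i g x"
    by (simp add: partial_deriv_def)
qed

lemma partial_deriv_mult:
  assumes "\<And>x. f differentiable (at x)" "\<And>x. g differentiable (at x)"
  shows "partial_deriv i (\<lambda>x. f x * g x)
    = (\<lambda>x. f x * partial_deriv i g x + partial_deriv i f x * g x)"
proof
  fix x
  have "(f has_derivative frechet_derivative f (at x)) (at x)"
      "(g has_derivative frechet_derivative g (at x)) (at x)"
    using assms by (auto simp: frechet_derivative_works[symmetric])
  from partial_deriv_eq[OF has_derivative_mult[OF this]]
  show "partial_deriv i (\<lambda>x. f x * g x) x = f x * partial_deriv i g x + partial_deriv i f x * g x"
    by (simp add: partial_deriv_def)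
qed

section \<open>Smoothness of algebras of functions\<close>

inductive_set generated_algebra :: "('x \<Rightarrow> complex) set \<Rightarrow> ('x \<Rightarrow> complex) set"
  for G where
  gen: "f \<in> G \<Longrightarrow> f \<in> generated_algebra G"
| const: "(\<lambda>x. c) \<in> generated_algebra G"
| add: "f \<in> generated_algebra G \<Longrightarrow> g \<in> generated_algebra G \<Longrightarrow>
    (\<lambda>x. f x + g x) \<in> generated_algebra G"
| mult: "f \<in> generated_algebra G \<Longrightarrow> g \<in> generated_algebra G \<Longrightarrow>
    (\<lambda>x. f x * g x) \<in> generated_algebra G"

text \<open>Sum and product rule keep derivatives inside the algebra once those of the generators
  are there, so no higher derivative is ever computed. It is used twice: with all smooth functions
  as generators, which gives smoothness of products, and with the family
  \<open>flat_exp\<close>.\<close>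

lemma generated_algebra_smooth:
  fixes G :: "(real^'d::finite \<Rightarrow> complex) set"
  assumes diff: "\<And>f x. f \<in> G \<Longrightarrow> f differentiable (at x)"
    and deriv: "\<And>f i. f \<in> G \<Longrightarrow> partial_deriv i f \<in> generated_algebra G"
    and "f \<in> generated_algebra G"
  shows "f \<in> smooth_functions"
proof (rule smooth_functions_coinduct)
  have *: "(\<forall>x. f differentiable (at x)) \<and> (\<forall>i. partial_deriv i f \<in> generated_algebra G)"
    if "f \<in> generated_algebra G" for f
    using that
  proof induction
    case (gen f)
    then show ?case using diff deriv by blast
  next
    case (const c)
    then show ?case by (simp add: partial_deriv_const generated_algebra.const)
  next
    case (add f g)
    then show ?case by (auto simp: partial_deriv_add intro: generated_algebra.add)
  next
    case (mult f g)
    then show ?case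
      by (auto simp: partial_deriv_mult intro!: generated_algebra.add intro: generated_algebra.mult)
  qed
  show "f differentiable_on UNIV" if "f \<in> generated_algebra G" for f
    using * that by (simp add: differentiable_on_eq_differentiable_at)
  show "partial_deriv i f \<in> generated_algebra G" if "f \<in> generated_algebra G" for f i
    using * that by blast
qed fact

lemma generated_algebra_smooth_functions:
  "generated_algebra smooth_functions \<subseteq> (smooth_functions :: (real^'d::finite \<Rightarrow> complex) set)"
proof
  fix f :: "real^'d \<Rightarrow> complex" assume "f \<in> generated_algebra smooth_functions"
  then show "f \<in> smooth_functions"
    by (rule generated_algebra_smooth[rotated 2])
      (simp_all add: smooth_differentiable smooth_partial_deriv generated_algebra.gen)
qed

lemma smooth_const: "(\<lambda>x. c) \<in> smooth_functions"
  using generated_algebra_smooth_functions generated_algebra.const by blast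

lemma smooth_mult:
  "f \<in> smooth_functions \<Longrightarrow> g \<in> smooth_functions \<Longrightarrow> (\<lambda>x. f x * g x) \<in> smooth_functions"
  using generated_algebra.mult[OF generated_algebra.gen generated_algebra.gen]
  by (rule generated_algebra_smooth_functions[THEN subsetD])

lemma smooth_prod:
  "finite I \<Longrightarrow> (\<And>i. i \<in> I \<Longrightarrow> f i \<in> smooth_functions) \<Longrightarrow> (\<lambda>x. \<Prod>i\<in>I. f i x) \<in> smooth_functions"
  by (induction I rule: finite_induct) (auto simp: smooth_const smooth_mult)


subsection \<open>Bump functions\<close>

text \<open>The derivative of \<open>t\<^sup>-\<^sup>k exp (-1/t)\<close> is a linear combination of functions of the same form.\<close>

definition flat_exp :: "nat \<Rightarrow> real \<Rightarrow> real" where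
  "flat_exp k t = (if t \<le> 0 then 0 else exp (- (1 / t)) / t ^ k)"

lemma flat_exp_tendsto_0: "((\<lambda>t. flat_exp k t) \<longlongrightarrow> 0) (at_right 0)"
proof -
  have "((\<lambda>t::real. inverse t ^ k / exp (inverse t)) \<longlongrightarrow> 0) (at_right 0)"
    by (rule filterlim_compose[OF tendsto_power_div_exp_0 filterlim_inverse_at_top_right])
  moreover have "eventually (\<lambda>t. inverse t ^ k / exp (inverse t) = flat_exp k t) (at_right 0)"
    using eventually_at_right_less
    by (rule eventually_mono) (auto simp: flat_exp_def exp_minus field_simps)
  ultimately show ?thesis by (rule Lim_transform_eventually)
qed

lemma DERIV_flat_exp:
  "(flat_exp k has_real_derivative flat_exp (k + 2) t - real k * flat_exp (k + 1) t) (at t)"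
proof -
  consider "t < 0" | "t = 0" | "t > 0" by linarith
  then show ?thesis
  proof cases
    case 1
    have "((\<lambda>_. 0) has_real_derivative 0) (at t)" by simp
    then have "(flat_exp k has_real_derivative 0) (at t)"
      by (rule has_field_derivative_transform_within_open[where S = "{..<0}"])
        (use 1 in \<open>auto simp: flat_exp_def\<close>)
    then show ?thesis using 1 by (simp add: flat_exp_def)
  next
    case 2
    \<comment> \<open>The two sides of 0 are treated separately: the difference quotient is 0 on the
      left and \<open>flat_exp (k + 1) h\<close> on the right.\<close>
    have "((\<lambda>h. (flat_exp k h - flat_exp k 0) / (h - 0)) \<longlongrightarrow> 0) (at_left 0)"
      by (rule tendsto_eventually)
        (auto simp: flat_exp_def eventually_at_filter intro!: always_eventually)
    moreover have "((\<lambda>h. (flat_exp k h - flat_exp k 0) / (h - 0)) \<longlongrightarrow> 0) (at_right 0)"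
    proof (rule Lim_transform_eventually[OF flat_exp_tendsto_0[of "k + 1"]])
      show "eventually (\<lambda>h. flat_exp (k + 1) h = (flat_exp k h - flat_exp k 0) / (h - 0)) (at_right 0)"
        using eventually_at_right_less
        by (rule eventually_mono) (auto simp: flat_exp_def field_simps)
    qed
    ultimately have "((\<lambda>h. (flat_exp k h - flat_exp k 0) / (h - 0)) \<longlongrightarrow> 0) (at 0)"
      by (simp add: filterlim_split_at)
    then show ?thesis using 2 by (simp add: has_field_derivative_iff flat_exp_def)
  next
    case 3
    have "((\<lambda>t. exp (- (1 / t)) * inverse t ^ k) has_real_derivative
        exp (- (1 / t)) * (1 / t\<^sup>2) * inverse t ^ k
          + exp (- (1 / t)) * (real k * (inverse t ^ (k - 1) * - (1 / t\<^sup>2)))) (at t)"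
      using 3 by (auto intro!: derivative_eq_intros simp: power2_eq_square divide_inverse algebra_simps)
    also have "exp (- (1 / t)) * (1 / t\<^sup>2) * inverse t ^ k
          + exp (- (1 / t)) * (real k * (inverse t ^ (k - 1) * - (1 / t\<^sup>2)))
        = flat_exp (k + 2) t - real k * flat_exp (k + 1) t"
    \<comment> \<open>For \<open>k = 0\<close> the exponent \<open>k - 1\<close> is truncated to 0;
      the factor \<open>real k\<close> removes that term.\<close>
    proof (cases k)
      case 0
      then show ?thesis using 3 by (simp add: flat_exp_def power2_eq_square)
    next
      case (Suc m)
      then show ?thesis using 3 by (simp add: flat_exp_def power2_eq_square field_simps)
    qed
    finally show ?thesis
      by (rule has_field_derivative_transform_within_open[where S = "{0<..}"])
        (use 3 in \<open>auto simp: flat_exp_def field_simps\<close>)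
  qed
qed

text \<open>Differentiation raises the index, so the functions for all \<open>k\<close> are taken
  together as generators. The affine argument covers both x - a and b - x for the two faces of a
  box.\<close>

lemma smooth_flat_exp:
  fixes i :: "'d::finite"
  shows "(\<lambda>x. complex_of_real (flat_exp k (c * x $ i + d))) \<in> smooth_functions"
proof -
  define G where "G = range (\<lambda>k (x::real^'d). complex_of_real (flat_exp k (c * x $ i + d)))"
  let ?D = "\<lambda>k t. flat_exp (k + 2) t - real k * flat_exp (k + 1) t"
  have deriv: "((\<lambda>x::real^'d. complex_of_real (flat_exp k (c * x $ i + d))) has_derivative
      (\<lambda>h. complex_of_real (?D k (c * x $ i + d) * (c * h $ i)))) (at x)" for k x
  proof -
    have "((\<lambda>x::real^'d. c * x $ i + d) has_derivative (\<lambda>h. c * h $ i)) (at x)"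
      by (auto intro!: derivative_eq_intros bounded_linear_imp_has_derivative bounded_linear_vec_nth)
    from has_derivative_compose[OF this DERIV_flat_exp[unfolded has_field_derivative_def]]
    show ?thesis by (intro has_derivative_of_real) (simp add: mult.commute)
  qed
  show ?thesis
  proof (rule generated_algebra_smooth)
    fix f :: "real^'d \<Rightarrow> complex" and j :: 'd assume "f \<in> G"
    then obtain k where f: "f = (\<lambda>x. complex_of_real (flat_exp k (c * x $ i + d)))"
      by (auto simp: G_def)
    show "f differentiable (at x)" for x
      unfolding f using deriv differentiable_def by blast
    define s where "s = complex_of_real (c * axis j 1 $ i)"
    have "partial_deriv j f = (\<lambda>x. s * complex_of_real (flat_exp (k + 2) (c * x $ i + d))
        + (- s * of_nat k) * complex_of_real (flat_exp (k + 1) (c * x $ i + d)))"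
      unfolding f by (rule ext, subst partial_deriv_eq[OF deriv]) (simp add: s_def algebra_simps)
    also have "\<dots> \<in> generated_algebra G"
      by (intro generated_algebra.add generated_algebra.mult generated_algebra.const
          generated_algebra.gen) (auto simp: G_def)
    finally show "partial_deriv j f \<in> generated_algebra G" .
  next
    show "(\<lambda>x. complex_of_real (flat_exp k (c * x $ i + d))) \<in> generated_algebra G"
      by (rule generated_algebra.gen) (auto simp: G_def)
  qed
qed

text \<open>For a fixed box, stretching the argument by n + 1 sends \<open>flat_exp 0\<close> to 1
  at positive and keeps it 0 at other points. The functions thus converge to the indicator of the
  open box without any convolution, while their support stays in the closed box and their modulus
  below 1. \<open>Suc\<close> keeps the factor positive for the first index.\<close>

definition bump :: "real^'d \<Rightarrow> real^'d \<Rightarrow> nat \<Rightarrow> real^'d::finite \<Rightarrow> complex" where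
  "bump a b n x = (\<Prod>i\<in>UNIV. complex_of_real (flat_exp 0 (real (Suc n) * (x $ i - a $ i)))
      * complex_of_real (flat_exp 0 (real (Suc n) * (b $ i - x $ i))))"

lemma smooth_bump: "bump a b n \<in> smooth_functions"
proof -
  have "(\<lambda>x. complex_of_real (flat_exp 0 (real (Suc n) * (x $ i - a $ i)))
      * complex_of_real (flat_exp 0 (real (Suc n) * (b $ i - x $ i)))) \<in> smooth_functions" for i
    using smooth_mult[OF smooth_flat_exp[of 0 "real (Suc n)" i "- real (Suc n) * a $ i"]
        smooth_flat_exp[of 0 "- real (Suc n)" i "real (Suc n) * b $ i"]]
    by (simp add: algebra_simps)
  then have "(\<lambda>x. \<Prod>i\<in>UNIV. complex_of_real (flat_exp 0 (real (Suc n) * (x $ i - a $ i)))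
      * complex_of_real (flat_exp 0 (real (Suc n) * (b $ i - x $ i)))) \<in> smooth_functions"
    by (intro smooth_prod) auto
  then show ?thesis unfolding bump_def[abs_def] .
qed

lemma bump_le_1: "cmod (bump a b n x) \<le> 1"
  unfolding bump_def prod_norm[symmetric]
  by (rule prod_le_1) (auto simp: norm_mult flat_exp_def mult_le_one)

lemma bump_eq_0_iff: "bump a b n x = 0 \<longleftrightarrow> x \<notin> box a b"
proof -
  have "flat_exp 0 (real (Suc n) * t) = 0 \<longleftrightarrow> t \<le> 0" for t
    by (simp add: flat_exp_def mult_le_0_iff del: of_nat_Suc)
  then have "bump a b n x = 0 \<longleftrightarrow> (\<exists>i. x $ i - a $ i \<le> 0 \<or> b $ i - x $ i \<le> 0)"
    by (simp add: bump_def del: of_nat_Suc)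
  then show ?thesis by (auto simp: mem_box_cart not_less not_le)
qed

lemma bump_tendsto_indicator: "(\<lambda>n. bump a b n x) \<longlonglongrightarrow> indicator (box a b) x"
proof (cases "x \<in> box a b")
  case False
  then have "bump a b n x = 0" for n by (simp add: bump_eq_0_iff)
  with False show ?thesis by simp
next
  case True
  have flat: "(\<lambda>n. complex_of_real (flat_exp 0 (real (Suc n) * t))) \<longlonglongrightarrow> 1" if "0 < t" for t
  proof -
    have "(\<lambda>n. complex_of_real (exp (- (1 / t * inverse (real (Suc n)))))) \<longlonglongrightarrow>
        complex_of_real (exp (- (1 / t * 0)))"
      by (intro tendsto_intros LIMSEQ_inverse_real_of_nat)
    moreover have "complex_of_real (exp (- (1 / t * inverse (real (Suc n)))))
        = complex_of_real (flat_exp 0 (real (Suc n) * t))" for n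
      using that by (simp add: flat_exp_def field_simps not_le mult_le_0_iff del: of_nat_Suc)
    ultimately show ?thesis by simp
  qed
  have "(\<lambda>n. bump a b n x) \<longlonglongrightarrow> (\<Prod>i\<in>(UNIV::'a set). 1 * 1)"
    unfolding bump_def using True by (intro tendsto_intros flat) (auto simp: mem_box_cart)
  then show ?thesis using True by simp
qed

lemma closure_support_bump: "closure {x. bump a b n x \<noteq> 0} \<subseteq> cbox a b"
  by (rule closure_minimal) (use box_subset_cbox in \<open>auto simp: bump_eq_0_iff\<close>)

lemma compact_support_bump: "compact (closure {x. bump a b n x \<noteq> 0})"
  using closure_support_bump compact_Int_closed[OF compact_cbox closed_closure]
  by (metis inf.absorb2)


subsection \<open>Test functions\<close>

lemma test_functions_iff:
  "\<phi> \<in> test_functions \<Omega> \<longleftrightarrow> \<phi> \<in> smooth_functions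
    \<and> compact (closure {x. \<phi> x \<noteq> 0}) \<and> closure {x. \<phi> x \<noteq> 0} \<subseteq> \<Omega>"
  by (simp add: test_functions_def smooth_functions_def)

lemma test_functionsD:
  assumes "\<phi> \<in> test_functions \<Omega>"
  shows "\<phi> \<in> smooth_functions" "compact (closure {x. \<phi> x \<noteq> 0})" "closure {x. \<phi> x \<noteq> 0} \<subseteq> \<Omega>"
  using assms by (auto simp: test_functions_iff)

lemma test_functions_subset_support:
  assumes "\<phi> \<in> test_functions \<Omega>" "\<psi> \<in> smooth_functions" "{x. \<psi> x \<noteq> 0} \<subseteq> closure {x. \<phi> x \<noteq> 0}"
  shows "\<psi> \<in> test_functions \<Omega>"
proof -
  have "closure {x. \<psi> x \<noteq> 0} \<subseteq> closure {x. \<phi> x \<noteq> 0}"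
    using assms(3) by (simp add: closure_minimal)
  moreover have "compact (closure {x. \<phi> x \<noteq> 0} \<inter> closure {x. \<psi> x \<noteq> 0})"
    using test_functionsD(2)[OF assms(1)] by (simp add: compact_Int_closed)
  ultimately show ?thesis
    using assms test_functionsD[OF assms(1)] by (auto simp: test_functions_iff inf.absorb2)
qed

lemma test_functions_mult:
  "\<psi> \<in> smooth_functions \<Longrightarrow> \<phi> \<in> test_functions \<Omega> \<Longrightarrow> (\<lambda>x. \<psi> x * \<phi> x) \<in> test_functions \<Omega>"
  by (rule test_functions_subset_support)
    (auto intro!: smooth_mult closure_subset[THEN subsetD] dest: test_functionsD)

lemma support_partial_deriv: "{x. partial_deriv i \<phi> x \<noteq> 0} \<subseteq> closure {x. \<phi> x \<noteq> 0}"
proof (rule subsetI, rule ccontr)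
  fix x assume x: "x \<in> {x. partial_deriv i \<phi> x \<noteq> 0}" "x \<notin> closure {x. \<phi> x \<noteq> 0}"
  have "((\<lambda>_. 0) has_derivative (\<lambda>_. 0)) (at x)" by simp
  then have "(\<phi> has_derivative (\<lambda>_. 0)) (at x)"
  proof (rule has_derivative_transform_within_open)
    show "open (- closure {x. \<phi> x \<noteq> 0})" by auto
    show "0 = \<phi> y" if "y \<in> - closure {x. \<phi> x \<noteq> 0}" for y
      using that closure_subset[of "{x. \<phi> x \<noteq> 0}"] by auto
  qed (use x in auto)
  then show False using x partial_deriv_eq by force
qed

lemma test_functions_partial_deriv:
  "\<phi> \<in> test_functions \<Omega> \<Longrightarrow> partial_deriv i \<phi> \<in> test_functions \<Omega>"
  by (rule test_functions_subset_support)
    (auto intro: smooth_partial_deriv support_partial_deriv[THEN subsetD] dest: test_functionsD)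

lemma test_functions_bounded:
  assumes "\<phi> \<in> test_functions \<Omega>"
  obtains C where "0 \<le> C" "\<And>x. cmod (\<phi> x) \<le> C"
proof -
  note \<phi> = test_functionsD[OF assms]
  have "bounded (\<phi> ` closure {x. \<phi> x \<noteq> 0})"
    by (intro compact_imp_bounded compact_continuous_image smooth_continuous_on \<phi>)
  then obtain C where C: "\<And>x. x \<in> closure {x. \<phi> x \<noteq> 0} \<Longrightarrow> cmod (\<phi> x) \<le> C"
    by (auto simp: bounded_iff)
  have "cmod (\<phi> x) \<le> max 0 C" for x
  proof (cases "\<phi> x = 0")
    case False
    then have "x \<in> closure {x. \<phi> x \<noteq> 0}"
      using closure_subset[of "{x. \<phi> x \<noteq> 0}"] by auto
    then show ?thesis using C by (simp add: le_max_iff_disj)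
  qed simp
  then show ?thesis by (intro that[of "max 0 C"]) auto
qed

lemma smooth_lebesgue_on_measurable:
  "f \<in> smooth_functions \<Longrightarrow> f \<in> borel_measurable (lebesgue_on \<Omega>)"
  by (intro measurable_restrict_space1 borel_measurable_if_D measurable_completion)
    (simp add: smooth_borel_measurable)

lemma test_functions_L2:
  assumes "\<phi> \<in> test_functions \<Omega>" "\<Omega> \<in> sets lebesgue"
  shows "\<phi> \<in> L2 (lebesgue_on \<Omega>)"
proof -
  note \<phi> = test_functionsD[OF assms(1)]
  obtain C where C: "\<And>x. cmod (\<phi> x) \<le> C" using test_functions_bounded[OF assms(1)] by blast
  define K where "K = closure {x. \<phi> x \<noteq> 0}"
  have K: "K \<in> sets lebesgue" "K \<subseteq> \<Omega>" "compact K" using \<phi> by (auto simp: K_def)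
  have "K \<in> sets (lebesgue_on \<Omega>)" using K assms(2) by (simp add: sets_restrict_space_iff)
  moreover have "emeasure (lebesgue_on \<Omega>) K < \<infinity>"
    using K assms(2) emeasure_compact_finite[OF K(3)] borel_compact[OF K(3)]
    by (simp add: emeasure_restrict_space)
  ultimately have "integrable (lebesgue_on \<Omega>) (indicator K :: _ \<Rightarrow> real)"
    by (intro integrable_real_indicator)
  moreover have "(\<lambda>x. (cmod (indicator K x))\<^sup>2) = (indicator K :: _ \<Rightarrow> real)"
    by (auto simp: indicator_def)
  ultimately have "indicator K \<in> L2 (lebesgue_on \<Omega>)"
    using \<open>K \<in> sets (lebesgue_on \<Omega>)\<close> by (simp add: L2_def)
  then show ?thesis
  proof (rule L2_dominated[rotated])
    show "AE x in lebesgue_on \<Omega>. cmod (\<phi> x) \<le> C * cmod (indicator K x :: complex)"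
      using C closure_subset[of "{x. \<phi> x \<noteq> 0}"] by (intro AE_I2) (auto simp: indicator_def K_def)
  qed (use \<phi> in \<open>simp add: smooth_lebesgue_on_measurable\<close>)
qed


subsection \<open>Test functions separate \<open>L\<^sub>2\<close>\<close>

lemma integral_lebesgue_on_subset:
  fixes f :: "'a::euclidean_space \<Rightarrow> complex"
  assumes "B \<in> sets lebesgue" "\<Omega> \<in> sets lebesgue" "B \<subseteq> \<Omega>"
  shows "integrable (lebesgue_on B) f \<longleftrightarrow> integrable (lebesgue_on \<Omega>) (\<lambda>x. indicator B x * f x)"
    and "(\<integral>x. f x \<partial>lebesgue_on B) = (\<integral>x. indicator B x * f x \<partial>lebesgue_on \<Omega>)"
proof -
  have "(\<lambda>x. indicator \<Omega> x *\<^sub>R (indicator B x * f x)) = (\<lambda>x. indicator B x *\<^sub>R f x)"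
    using assms(3) by (auto simp: indicator_def fun_eq_iff)
  then show "integrable (lebesgue_on B) f \<longleftrightarrow> integrable (lebesgue_on \<Omega>) (\<lambda>x. indicator B x * f x)"
    and "(\<integral>x. f x \<partial>lebesgue_on B) = (\<integral>x. indicator B x * f x \<partial>lebesgue_on \<Omega>)"
    using assms by (simp_all add: integrable_restrict_space integral_restrict_space)
qed

lemma indicator_box_L2:
  assumes "\<Omega> \<in> sets lebesgue" "box a b \<subseteq> \<Omega>"
  shows "indicator (box a b) \<in> L2 (lebesgue_on \<Omega>)"
proof -
  have B: "box a b \<in> sets (lebesgue_on \<Omega>)" using assms by (simp add: sets_restrict_space_iff)
  moreover have "emeasure (lebesgue_on \<Omega>) (box a b) < \<infinity>"
    using assms emeasure_lborel_box_finite[of a b] by (simp add: emeasure_restrict_space)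
  ultimately have "integrable (lebesgue_on \<Omega>) (indicator (box a b) :: _ \<Rightarrow> real)"
    by (intro integrable_real_indicator)
  moreover have "(\<lambda>x. (cmod (indicator (box a b) x))\<^sup>2) = (indicator (box a b) :: _ \<Rightarrow> real)"
    by (auto simp: indicator_def)
  ultimately show ?thesis using B by (simp add: L2_def)
qed

text \<open>Open boxes are stable under intersection and generate the Borel sets, so the integral of
  \<open>h\<close> vanishes over all Borel subsets of the box; complements work because the big box
  is itself among the boxes with integral 0. A function with this property for all measurable sets
  is null.\<close>

lemma AE_zero_if_box_integrals_zero:
  fixes h :: "'a::euclidean_space \<Rightarrow> complex"
  assumes h: "integrable (lebesgue_on (box a b)) h"
    and zero: "\<And>c d. box c d \<subseteq> box a b \<Longrightarrow> (\<integral>x. indicator (box c d) x * h x \<partial>lebesgue_on (box a b)) = 0"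
  shows "AE x in lebesgue_on (box a b). h x = 0"
proof -
  define M where "M = lebesgue_on (box a b)"
  interpret finite_measure M
    unfolding M_def by (rule finite_measure_lebesgue_on) simp
  have space_M: "space M = box a b" by (simp add: M_def)
  have meas: "A \<inter> box a b \<in> sets M" if "A \<in> sets borel" for A
    using that by (auto simp: M_def sets_restrict_space)
  have int: "set_integrable M (A \<inter> box a b) h" if "A \<in> sets borel" for A
    unfolding set_integrable_def using h meas[OF that] by (simp add: M_def integrable_mult_indicator)
  let ?G = "range (\<lambda>(c, d). box c d :: 'a set)"
  have borel: "sets (borel :: 'a measure) = sigma_sets UNIV ?G"
    unfolding borel_eq_box by simp
  have "Int_stable ?G" "?G \<subseteq> Pow UNIV"
    by (auto simp: Int_stable_def box_Int_box)
  then have null: "set_lebesgue_integral M (A \<inter> box a b) h = 0" if "A \<in> sets borel" for A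
    using that unfolding borel
  proof (induction rule: sigma_sets_induct_disjoint)
    case (basic A)
    then obtain c d where A: "A = box c d" by auto
    obtain c' d' where eq: "box c d \<inter> box a b = box c' d'" using box_Int_box by blast
    then have "box c' d' \<subseteq> box a b" by blast
    moreover have "(\<lambda>x. indicator (box c' d') x *\<^sub>R h x) = (\<lambda>x. indicator (box c' d') x * h x)"
      by (auto simp: indicator_def fun_eq_iff)
    ultimately show ?case
      using zero unfolding A eq by (simp add: set_lebesgue_integral_def M_def)
  next
    case empty
    then show ?case by (simp add: set_lebesgue_integral_def)
  next
    case (compl A)
    have A: "A \<in> sets borel" using compl(1) unfolding borel .
    have "(\<lambda>x. indicator ((UNIV - A) \<inter> box a b) x *\<^sub>R h x)
        = (\<lambda>x. indicator (box a b) x * h x - indicator (A \<inter> box a b) x *\<^sub>R h x)"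
      by (auto simp: indicator_def fun_eq_iff)
    moreover have "integrable M (\<lambda>x. indicator (box a b) x * h x)"
      using h integral_lebesgue_on_subset(1)[of "box a b" "box a b" h] by (simp add: M_def)
    ultimately show ?case
      using compl(2) zero[of a b] int[OF A]
      by (simp add: set_lebesgue_integral_def set_integrable_def M_def)
  next
    case (union A)
    have A: "A i \<in> sets borel" for i using union(2) unfolding borel by auto
    have "(\<Union>i. A i) \<in> sets borel" using A by auto
    from int[OF this] have "set_integrable M (\<Union>i. A i \<inter> box a b) h" by (simp add: Int_UN_distrib2)
    moreover have "(A i \<inter> box a b) \<inter> (A j \<inter> box a b) = {}" if "i \<noteq> j" for i j
      using union(1) that by (auto simp: disjoint_family_on_def)
    ultimately have "set_lebesgue_integral M (\<Union>i. A i \<inter> box a b) h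
        = (\<Sum>i. set_lebesgue_integral M (A i \<inter> box a b) h)"
      using meas A by (intro lebesgue_integral_countable_add) auto
    then show ?case using union(3) by (simp add: Int_UN_distrib2)
  qed
  have "AE x in M. h x = 0"
  proof (rule density_zero)
    show "integrable M h" using h by (simp add: M_def)
    fix A assume A: "A \<in> sets M"
    then have "A \<in> sets lebesgue" "A \<subseteq> box a b"
      by (auto simp: M_def sets_restrict_space)
    \<comment> \<open>The measurable sets here are Lebesgue sets, and the induction covered Borel
      sets only; the two differ by null sets.\<close>
    then obtain S N N' where S: "A = S \<union> N" "N \<subseteq> N'" "N' \<in> null_sets lborel" "S \<in> sets lborel"
      by (auto elim: sets_completionE)
    have "AE x in lebesgue. x \<notin> N'" using S(3) by (intro AE_completion AE_not_in)
    then have "AE x in M. x \<notin> N'"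
      unfolding M_def by (subst AE_restrict_space_iff) (auto elim: eventually_mono)
    then have "set_lebesgue_integral M A h = set_lebesgue_integral M (S \<inter> box a b) h"
      unfolding set_lebesgue_integral_def
    proof (intro integral_cong_AE)
      show "(\<lambda>x. indicator A x *\<^sub>R h x) \<in> borel_measurable M"
          "(\<lambda>x. indicator (S \<inter> box a b) x *\<^sub>R h x) \<in> borel_measurable M"
        using A meas[of S] S(4) h
        by (auto intro!: borel_measurable_scaleR borel_measurable_indicator simp: M_def)
      show "AE x in M. indicator A x *\<^sub>R h x = indicator (S \<inter> box a b) x *\<^sub>R h x"
        using \<open>AE x in M. x \<notin> N'\<close>
        by eventually_elim (use S \<open>A \<subseteq> box a b\<close> in \<open>auto simp: indicator_def\<close>)
    qed
    then show "set_lebesgue_integral M A h = 0" using null S(4) by simp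
  qed
  then show ?thesis unfolding M_def .
qed

lemma bump_test_function:
  "closure (box a b) \<subseteq> \<Omega> \<Longrightarrow> bump a b n \<in> test_functions \<Omega>"
  using compact_support_bump[of a b n] by (simp add: test_functions_iff smooth_bump bump_eq_0_iff)

text \<open>The fundamental lemma of the calculus of variations, without mollifiers: in a closed box
  inside \<Omega>, bumps of subboxes are test functions and tend to indicators. Countably many
  closed boxes fill \<Omega>, and their frontiers are null.\<close>

lemma AE_zero_if_test_integrals_zero:
  fixes \<Omega> :: "(real^'d::finite) set"
  assumes \<Omega>: "open \<Omega>" and h: "h \<in> L2 (lebesgue_on \<Omega>)"
    and zero: "\<And>\<phi>. \<phi> \<in> test_functions \<Omega> \<Longrightarrow> (\<integral>x. h x * \<phi> x \<partial>lebesgue_on \<Omega>) = 0"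
  shows "AE x in lebesgue_on \<Omega>. h x = 0"
proof -
  have \<Omega>m: "\<Omega> \<in> sets lebesgue" using \<Omega> by simp
  have box: "AE x in lebesgue. x \<in> box a b \<longrightarrow> h x = 0" if ab: "cbox a b \<subseteq> \<Omega>" for a b
  proof -
    have sub: "box a b \<subseteq> \<Omega>" using ab box_subset_cbox by blast
    note restr = integral_lebesgue_on_subset[of "box a b", OF _ \<Omega>m sub, simplified]
    have ind: "integrable (lebesgue_on \<Omega>) (\<lambda>x. indicator (box a b) x * h x)"
      using indicator_box_L2[OF \<Omega>m sub] h by (rule integrable_mult_L2)
    have "AE x in lebesgue_on (box a b). h x = 0"
    proof (rule AE_zero_if_box_integrals_zero)
      show "integrable (lebesgue_on (box a b)) h" using ind by (simp add: restr)
      fix c d assume cd: "box c d \<subseteq> box a b"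
      have "closure (box c d) \<subseteq> \<Omega>" using cd ab sub
        by (meson closed_cbox closure_minimal box_subset_cbox order_trans)
      then have \<phi>: "bump c d n \<in> test_functions \<Omega>" for n by (rule bump_test_function)
      have "(\<lambda>n. \<integral>x. h x * bump c d n x \<partial>lebesgue_on \<Omega>)
          \<longlonglongrightarrow> (\<integral>x. h x * indicator (box c d) x \<partial>lebesgue_on \<Omega>)"
      proof (rule integral_dominated_convergence)
        \<comment> \<open>\<open>h\<close> itself need not be integrable over \<Omega>, but it is
          over a bounded box, which contains the points where the bumps are nonzero.\<close>
        show "integrable (lebesgue_on \<Omega>) (\<lambda>x. cmod (indicator (box a b) x * h x))"
          using ind by (rule integrable_norm)
        show "AE x in lebesgue_on \<Omega>. cmod (h x * bump c d n x) \<le> cmod (indicator (box a b) x * h x)" for n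
        proof (rule AE_I2)
          fix x show "cmod (h x * bump c d n x) \<le> cmod (indicator (box a b) x * h x)"
            using bump_le_1[of c d n x] bump_eq_0_iff[of c d n x] cd
            by (cases "x \<in> box c d") (auto simp: norm_mult mult_left_le)
        qed
        show "(\<lambda>x. h x * indicator (box c d) x) \<in> borel_measurable (lebesgue_on \<Omega>)"
          using L2_measurable[OF h] cd sub \<Omega>m
          by (intro borel_measurable_times borel_measurable_indicator)
            (auto simp: sets_restrict_space_iff)
        show "(\<lambda>x. h x * bump c d n x) \<in> borel_measurable (lebesgue_on \<Omega>)" for n
          using L2_measurable[OF h] smooth_lebesgue_on_measurable[OF smooth_bump]
          by (intro borel_measurable_times)
      qed (intro AE_I2 tendsto_intros bump_tendsto_indicator)
      then have "(\<integral>x. h x * indicator (box c d) x \<partial>lebesgue_on \<Omega>) = 0"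
        using zero[OF \<phi>] by (simp add: LIMSEQ_const_iff)
      moreover have "(\<lambda>x. indicator (box a b) x * (indicator (box c d) x * h x))
          = (\<lambda>x. h x * indicator (box c d) x)"
        using cd by (auto simp: indicator_def fun_eq_iff)
      ultimately show "(\<integral>x. indicator (box c d) x * h x \<partial>lebesgue_on (box a b)) = 0"
        by (simp add: restr)
    qed
    then show ?thesis by (simp add: AE_restrict_space_iff)
  qed
  obtain \<D> where \<D>: "countable \<D>" "\<D> \<subseteq> Pow \<Omega>" "\<And>X. X \<in> \<D> \<Longrightarrow> \<exists>a b. X = cbox a b" "\<Union>\<D> = \<Omega>"
    using open_countable_Union_open_cbox[OF \<Omega>] by blast
  have "AE x in lebesgue. x \<in> X \<longrightarrow> h x = 0" if XD: "X \<in> \<D>" for X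
  proof -
    obtain a b where X: "X = cbox a b" using \<D>(3) XD by blast
    have "cbox a b - box a b \<in> null_sets lebesgue"
      using negligible_frontier_interval by (simp add: negligible_iff_null_sets)
    then have "AE x in lebesgue. x \<notin> cbox a b - box a b" by (rule AE_not_in)
    moreover have "AE x in lebesgue. x \<in> box a b \<longrightarrow> h x = 0"
      using box \<D>(2) XD X by blast
    ultimately show ?thesis unfolding X by eventually_elim auto
  qed
  then have "AE x in lebesgue. \<forall>X\<in>\<D>. x \<in> X \<longrightarrow> h x = 0"
    unfolding AE_ball_countable[OF \<D>(1)] by blast
  then have "AE x in lebesgue. x \<in> \<Omega> \<longrightarrow> h x = 0"
    by eventually_elim (use \<D>(4) in auto)
  then show ?thesis using \<Omega>m by (simp add: AE_restrict_space_iff)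
qed


subsection \<open>Calculus of weak derivatives\<close>

lemma H1_L2: "u \<in> H1 \<Omega> \<Longrightarrow> u \<in> L2 (lebesgue_on \<Omega>)"
  by (simp add: H1_def)

lemma H1_I:
  assumes "u \<in> L2 (lebesgue_on \<Omega>)"
    and "\<And>i. g i \<in> L2 (lebesgue_on \<Omega>)" "\<And>i. is_weak_deriv \<Omega> i u (g i)"
  shows "u \<in> H1 \<Omega>"
  using assms by (auto simp: H1_def)

lemma
  assumes "u \<in> H1 \<Omega>"
  shows weak_deriv_L2: "weak_deriv \<Omega> i u \<in> L2 (lebesgue_on \<Omega>)"
    and is_weak_deriv_weak_deriv: "is_weak_deriv \<Omega> i u (weak_deriv \<Omega> i u)"
proof -
  have "\<exists>g. g \<in> L2 (lebesgue_on \<Omega>) \<and> is_weak_deriv \<Omega> i u g"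
    using assms by (auto simp: H1_def)
  from someI_ex[OF this]
  show "weak_deriv \<Omega> i u \<in> L2 (lebesgue_on \<Omega>)" "is_weak_deriv \<Omega> i u (weak_deriv \<Omega> i u)"
    by (simp_all add: weak_deriv_def)
qed

lemma is_weak_derivD:
  "is_weak_deriv \<Omega> i u g \<Longrightarrow> \<phi> \<in> test_functions \<Omega> \<Longrightarrow>
    (\<integral>x. u x * partial_deriv i \<phi> x \<partial>lebesgue_on \<Omega>) = - (\<integral>x. g x * \<phi> x \<partial>lebesgue_on \<Omega>)"
  by (simp add: is_weak_deriv_def)

context
  fixes \<Omega> :: "(real^'d::finite) set"
  assumes \<Omega>: "open \<Omega>"
begin

lemma \<Omega>_measurable: "\<Omega> \<in> sets lebesgue"
  using \<Omega> by simp

lemma integrable_mult_test: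
  "u \<in> L2 (lebesgue_on \<Omega>) \<Longrightarrow> \<phi> \<in> test_functions \<Omega> \<Longrightarrow> integrable (lebesgue_on \<Omega>) (\<lambda>x. u x * \<phi> x)"
  using integrable_mult_L2 test_functions_L2 \<Omega>_measurable by blast

lemma weak_deriv_unique:
  assumes "u \<in> H1 \<Omega>" "g \<in> L2 (lebesgue_on \<Omega>)" "is_weak_deriv \<Omega> i u g"
  shows "AE x in lebesgue_on \<Omega>. weak_deriv \<Omega> i u x = g x"
proof -
  have "AE x in lebesgue_on \<Omega>. weak_deriv \<Omega> i u x - g x = 0"
  proof (rule AE_zero_if_test_integrals_zero[OF \<Omega>])
    show "(\<lambda>x. weak_deriv \<Omega> i u x - g x) \<in> L2 (lebesgue_on \<Omega>)"
      using assms by (intro L2_diff weak_deriv_L2)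
    fix \<phi> assume \<phi>: "\<phi> \<in> test_functions \<Omega>"
    show "(\<integral>x. (weak_deriv \<Omega> i u x - g x) * \<phi> x \<partial>lebesgue_on \<Omega>) = 0"
      using is_weak_derivD[OF is_weak_deriv_weak_deriv[OF assms(1)] \<phi>, of i]
        is_weak_derivD[OF assms(3) \<phi>] assms \<phi>
      by (simp add: left_diff_distrib integrable_mult_test weak_deriv_L2)
  qed
  then show ?thesis by eventually_elim simp
qed

lemma is_weak_deriv_linear:
  assumes "u \<in> L2 (lebesgue_on \<Omega>)" "v \<in> L2 (lebesgue_on \<Omega>)"
    and "g \<in> L2 (lebesgue_on \<Omega>)" "h \<in> L2 (lebesgue_on \<Omega>)"
    and "is_weak_deriv \<Omega> i u g" "is_weak_deriv \<Omega> i v h"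
  shows "is_weak_deriv \<Omega> i (\<lambda>x. c * u x + d * v x) (\<lambda>x. c * g x + d * h x)"
  unfolding is_weak_deriv_def
proof
  fix \<phi> assume \<phi>: "\<phi> \<in> test_functions \<Omega>"
  note \<phi>' = test_functions_partial_deriv[OF \<phi>, of i]
  note int = integrable_mult_test[OF _ \<phi>] integrable_mult_test[OF _ \<phi>']
  show "(\<integral>x. (c * u x + d * v x) * partial_deriv i \<phi> x \<partial>lebesgue_on \<Omega>)
      = - (\<integral>x. (c * g x + d * h x) * \<phi> x \<partial>lebesgue_on \<Omega>)"
    using assms(1-4) is_weak_derivD[OF assms(5) \<phi>] is_weak_derivD[OF assms(6) \<phi>]
    by (simp add: distrib_right mult.assoc int)
qed

lemma
  assumes "u \<in> H1 \<Omega>" "v \<in> H1 \<Omega>"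
  shows H1_linear: "(\<lambda>x. c * u x + d * v x) \<in> H1 \<Omega>"
    and weak_deriv_linear: "AE x in lebesgue_on \<Omega>.
      weak_deriv \<Omega> i (\<lambda>x. c * u x + d * v x) x = c * weak_deriv \<Omega> i u x + d * weak_deriv \<Omega> i v x"
proof -
  have L2: "(\<lambda>x. c * u x + d * v x) \<in> L2 (lebesgue_on \<Omega>)"
      "(\<lambda>x. c * weak_deriv \<Omega> i u x + d * weak_deriv \<Omega> i v x) \<in> L2 (lebesgue_on \<Omega>)" for i
    using assms by (simp_all add: L2_add L2_cmult weak_deriv_L2 H1_L2)
  have deriv: "is_weak_deriv \<Omega> i (\<lambda>x. c * u x + d * v x)
      (\<lambda>x. c * weak_deriv \<Omega> i u x + d * weak_deriv \<Omega> i v x)" for i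
    using assms by (intro is_weak_deriv_linear weak_deriv_L2 is_weak_deriv_weak_deriv H1_L2)
  show H1: "(\<lambda>x. c * u x + d * v x) \<in> H1 \<Omega>" by (rule H1_I[OF L2 deriv])
  show "AE x in lebesgue_on \<Omega>.
      weak_deriv \<Omega> i (\<lambda>x. c * u x + d * v x) x = c * weak_deriv \<Omega> i u x + d * weak_deriv \<Omega> i v x"
    by (rule weak_deriv_unique[OF H1 L2(2) deriv])
qed

lemma test_UNIV_mult_L2:
  assumes "\<psi> \<in> test_functions UNIV" "u \<in> L2 (lebesgue_on \<Omega>)"
  shows "(\<lambda>x. \<psi> x * u x) \<in> L2 (lebesgue_on \<Omega>)"
proof -
  obtain C where "\<And>x. cmod (\<psi> x) \<le> C" using test_functions_bounded[OF assms(1)] by blast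
  then show ?thesis
    using assms by (intro L2_mult_bounded[where C = C] smooth_lebesgue_on_measurable)
      (auto dest: test_functionsD)
qed

text \<open>The factor moves to the test function: \<psi> times the derivative of \<phi> is the
  derivative of \<psi> \<phi> minus \<phi> times that of \<psi>, and \<psi> \<phi> is again a test
  function on \<Omega>. The support of \<psi> may meet the boundary, as it must in order to localise
  traces.\<close>

lemma is_weak_deriv_mult:
  assumes u: "u \<in> L2 (lebesgue_on \<Omega>)" and g: "g \<in> L2 (lebesgue_on \<Omega>)"
    and deriv: "is_weak_deriv \<Omega> i u g" and \<psi>: "\<psi> \<in> test_functions UNIV"
  shows "is_weak_deriv \<Omega> i (\<lambda>x. \<psi> x * u x) (\<lambda>x. \<psi> x * g x + partial_deriv i \<psi> x * u x)"
  unfolding is_weak_deriv_def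
proof
  fix \<phi> assume \<phi>: "\<phi> \<in> test_functions \<Omega>"
  note smooth = test_functionsD(1)[OF \<psi>] test_functionsD(1)[OF \<phi>]
  note product_rule = partial_deriv_mult[OF smooth_differentiable[OF smooth(1)] smooth_differentiable[OF smooth(2)]]
  note \<psi>\<phi> = test_functions_mult[OF smooth(1) \<phi>]
  note \<psi>'\<phi> = test_functions_mult[OF smooth_partial_deriv[OF smooth(1)] \<phi>, of i]
  note int = integrable_mult_test[OF u test_functions_partial_deriv[OF \<psi>\<phi>], of i]
    integrable_mult_test[OF u \<psi>'\<phi>] integrable_mult_test[OF g \<psi>\<phi>]
  have "(\<integral>x. \<psi> x * u x * partial_deriv i \<phi> x \<partial>lebesgue_on \<Omega>)
      = (\<integral>x. u x * partial_deriv i (\<lambda>x. \<psi> x * \<phi> x) x - u x * (partial_deriv i \<psi> x * \<phi> x) \<partial>lebesgue_on \<Omega>)"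
    unfolding product_rule by (simp add: algebra_simps)
  also have "\<dots> = - (\<integral>x. g x * (\<psi> x * \<phi> x) \<partial>lebesgue_on \<Omega>)
      - (\<integral>x. u x * (partial_deriv i \<psi> x * \<phi> x) \<partial>lebesgue_on \<Omega>)"
    using int is_weak_derivD[OF deriv \<psi>\<phi>] by (subst Bochner_Integration.integral_diff) simp_all
  also have "\<dots> = - (\<integral>x. g x * (\<psi> x * \<phi> x) + u x * (partial_deriv i \<psi> x * \<phi> x) \<partial>lebesgue_on \<Omega>)"
    using int by simp
  also have "\<dots> = - (\<integral>x. (\<psi> x * g x + partial_deriv i \<psi> x * u x) * \<phi> x \<partial>lebesgue_on \<Omega>)"
    by (simp add: algebra_simps)
  finally show "(\<integral>x. \<psi> x * u x * partial_deriv i \<phi> x \<partial>lebesgue_on \<Omega>)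
      = - (\<integral>x. (\<psi> x * g x + partial_deriv i \<psi> x * u x) * \<phi> x \<partial>lebesgue_on \<Omega>)" .
qed

lemma
  assumes u: "u \<in> H1 \<Omega>" and \<psi>: "\<psi> \<in> test_functions UNIV"
  shows H1_mult: "(\<lambda>x. \<psi> x * u x) \<in> H1 \<Omega>"
    and weak_deriv_mult: "AE x in lebesgue_on \<Omega>.
      weak_deriv \<Omega> i (\<lambda>x. \<psi> x * u x) x = \<psi> x * weak_deriv \<Omega> i u x + partial_deriv i \<psi> x * u x"
proof -
  have L2: "(\<lambda>x. \<psi> x * u x) \<in> L2 (lebesgue_on \<Omega>)"
      "(\<lambda>x. \<psi> x * weak_deriv \<Omega> i u x + partial_deriv i \<psi> x * u x) \<in> L2 (lebesgue_on \<Omega>)" for i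
    using u \<psi>
    by (simp_all add: L2_add test_UNIV_mult_L2 weak_deriv_L2 H1_L2 test_functions_partial_deriv)
  have deriv: "is_weak_deriv \<Omega> i (\<lambda>x. \<psi> x * u x)
      (\<lambda>x. \<psi> x * weak_deriv \<Omega> i u x + partial_deriv i \<psi> x * u x)" for i
    using u \<psi> by (intro is_weak_deriv_mult weak_deriv_L2 is_weak_deriv_weak_deriv H1_L2)
  show H1: "(\<lambda>x. \<psi> x * u x) \<in> H1 \<Omega>" by (rule H1_I[OF L2 deriv])
  show "AE x in lebesgue_on \<Omega>.
      weak_deriv \<Omega> i (\<lambda>x. \<psi> x * u x) x = \<psi> x * weak_deriv \<Omega> i u x + partial_deriv i \<psi> x * u x"
    by (rule weak_deriv_unique[OF H1 L2(2) deriv])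
qed

end


subsection \<open>Sectorial forms with bounded coefficients\<close>

text \<open>For positive p and q, s p + q / s has minimum 2 sqrt (p q) at s = sqrt (q / p). Adding e
  > 0 to both keeps this choice meaningful when one of them vanishes; then e tends to 0.\<close>

lemma le_mult_sqrt_if_le_scaled_sum:
  fixes x :: real
  assumes "\<And>s. 0 < s \<Longrightarrow> x \<le> K * (s * p + q / s)" "0 \<le> p" "0 \<le> q" "0 \<le> K"
  shows "x \<le> 2 * K * (sqrt p * sqrt q)"
proof (rule tendsto_lowerbound)
  show "((\<lambda>e. 2 * K * (sqrt (p + e) * sqrt (q + e))) \<longlongrightarrow> 2 * K * (sqrt p * sqrt q)) (at_right 0)"
    by (rule tendsto_eq_intros refl | simp)+
  show "eventually (\<lambda>e. x \<le> 2 * K * (sqrt (p + e) * sqrt (q + e))) (at_right 0)"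
    using eventually_at_right_less
  proof eventually_elim
    case (elim e)
    define a b where "a = sqrt (p + e)" and "b = sqrt (q + e)"
    have pos: "0 < a" "0 < b" and sq: "p + e = a * a" "q + e = b * b"
      using elim assms by (auto simp: a_def b_def)
    have "x \<le> K * (b / a * p + q / (b / a))" using assms(1)[of "b / a"] pos by simp
    also have "\<dots> \<le> K * (b / a * (p + e) + (q + e) / (b / a))"
      using assms pos elim by (intro mult_left_mono add_mono divide_right_mono) auto
    also have "\<dots> = 2 * K * (a * b)" unfolding sq using pos by (simp add: field_simps)
    finally show ?case by (simp add: a_def b_def)
  qed
qed simp

lemma Re_of_real_mult: "Re (complex_of_real r * z) = r * Re z"
  by simp

text \<open>The sector condition appears as an inequality that survives integration, with
  \<open>K\<close> the inverse cosine value of the angle in the application. The quantifier over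
  \<xi> stands inside the a.e. statement so that \<xi> may depend on the point.\<close>

locale sectorial_coefficients =
  fixes M :: "'x measure" and A :: "'d::finite \<Rightarrow> 'd \<Rightarrow> 'x \<Rightarrow> complex" and K :: real
  assumes L_infinity: "A i j \<in> L_infinity M"
    and sectorial: "AE x in M. \<forall>\<xi> :: 'd \<Rightarrow> complex.
      cmod (\<Sum>i\<in>UNIV. \<Sum>j\<in>UNIV. \<xi> i * A i j x * cnj (\<xi> j))
        \<le> K * Re (\<Sum>i\<in>UNIV. \<Sum>j\<in>UNIV. \<xi> i * A i j x * cnj (\<xi> j))"
    and K_pos: "0 < K"
begin

text \<open>The Neumann form with arbitrary tuples of functions in place of gradients, so that the
  two parts of the product rule can be estimated separately.\<close>

definition B :: "('d \<Rightarrow> 'x \<Rightarrow> complex) \<Rightarrow> ('d \<Rightarrow> 'x \<Rightarrow> complex) \<Rightarrow> complex" where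
  "B G H = (\<Sum>i\<in>UNIV. \<Sum>j\<in>UNIV. \<integral>x. G i x * A i j x * cnj (H j x) \<partial>M)"

lemma measurable_A [measurable]: "A i j \<in> borel_measurable M"
  using L_infinity by (simp add: L_infinity_def)

lemma bounded_A:
  obtains C where "\<And>i j. AE x in M. cmod (A i j x) \<le> C i j"
proof -
  have "\<forall>i j. \<exists>C. AE x in M. cmod (A i j x) \<le> C"
    using L_infinity by (simp add: L_infinity_def)
  then obtain C where "\<forall>i j. AE x in M. cmod (A i j x) \<le> C i j" by metis
  then show ?thesis by (intro that[of C]) blast
qed

lemma integrable_term:
  assumes "g \<in> L2 M" "h \<in> L2 M"
  shows "integrable M (\<lambda>x. g x * A i j x * cnj (h x))"
proof -
  obtain C where C: "\<And>i j. AE x in M. cmod (A i j x) \<le> C i j" using bounded_A by blast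
  have "(\<lambda>x. A i j x * g x) \<in> L2 M"
    by (rule L2_mult_bounded[OF assms(1) measurable_A C])
  moreover have "(\<lambda>x. cnj (h x)) \<in> L2 M"
  proof (rule L2_dominated[OF _ assms(2), where C = 1])
    show "(\<lambda>x. cnj (h x)) \<in> borel_measurable M"
      by (rule borel_measurable_continuous_on[OF continuous_on_cnj[OF continuous_on_id]
            L2_measurable[OF assms(2)]])
  qed simp
  ultimately have "integrable M (\<lambda>x. A i j x * g x * cnj (h x))" by (rule integrable_mult_L2)
  then show ?thesis by (simp add: mult.commute[of "g _"])
qed

lemma B_cong_AE:
  assumes "\<And>i. G i \<in> borel_measurable M" "\<And>i. H i \<in> borel_measurable M"
    "\<And>i. G' i \<in> borel_measurable M" "\<And>i. H' i \<in> borel_measurable M"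
    and "\<And>i. AE x in M. G i x = G' i x" "\<And>i. AE x in M. H i x = H' i x"
  shows "B G H = B G' H'"
  unfolding B_def
proof (intro sum.cong refl integral_cong_AE)
  fix i j
  have cnj: "(\<lambda>x. cnj (f x)) \<in> borel_measurable M" if "f \<in> borel_measurable M" for f
    by (rule borel_measurable_continuous_on[OF continuous_on_cnj[OF continuous_on_id] that])
  show "(\<lambda>x. G i x * A i j x * cnj (H j x)) \<in> borel_measurable M"
      "(\<lambda>x. G' i x * A i j x * cnj (H' j x)) \<in> borel_measurable M"
    using assms(1-4) cnj by (auto intro!: borel_measurable_times)
  show "AE x in M. G i x * A i j x * cnj (H j x) = G' i x * A i j x * cnj (H' j x)"
    using assms(5)[of i] assms(6)[of j] by eventually_elim simp
qed

lemma B_linear_left: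
  assumes "\<And>i. G i \<in> L2 M" "\<And>i. G' i \<in> L2 M" "\<And>i. H i \<in> L2 M"
  shows "B (\<lambda>i x. c * G i x + d * G' i x) H = c * B G H + d * B G' H"
proof -
  have "(\<integral>x. (c * G i x + d * G' i x) * A i j x * cnj (H j x) \<partial>M)
      = c * (\<integral>x. G i x * A i j x * cnj (H j x) \<partial>M) + d * (\<integral>x. G' i x * A i j x * cnj (H j x) \<partial>M)" for i j
  proof -
    have "(\<integral>x. (c * G i x + d * G' i x) * A i j x * cnj (H j x) \<partial>M)
        = (\<integral>x. c * (G i x * A i j x * cnj (H j x)) + d * (G' i x * A i j x * cnj (H j x)) \<partial>M)"
      by (simp add: algebra_simps)
    also have "\<dots> = c * (\<integral>x. G i x * A i j x * cnj (H j x) \<partial>M) + d * (\<integral>x. G' i x * A i j x * cnj (H j x) \<partial>M)"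
      using assms by (simp add: integrable_term)
    finally show ?thesis .
  qed
  then show ?thesis by (simp add: B_def sum.distrib sum_distrib_left)
qed

lemma B_linear_right:
  assumes "\<And>i. G i \<in> L2 M" "\<And>i. H i \<in> L2 M" "\<And>i. H' i \<in> L2 M"
  shows "B G (\<lambda>i x. c * H i x + d * H' i x) = cnj c * B G H + cnj d * B G H'"
proof -
  have "(\<integral>x. G i x * A i j x * cnj (c * H j x + d * H' j x) \<partial>M)
      = cnj c * (\<integral>x. G i x * A i j x * cnj (H j x) \<partial>M) + cnj d * (\<integral>x. G i x * A i j x * cnj (H' j x) \<partial>M)" for i j
  proof -
    have "(\<integral>x. G i x * A i j x * cnj (c * H j x + d * H' j x) \<partial>M)
        = (\<integral>x. cnj c * (G i x * A i j x * cnj (H j x)) + cnj d * (G i x * A i j x * cnj (H' j x)) \<partial>M)"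
      by (simp add: algebra_simps)
    also have "\<dots> = cnj c * (\<integral>x. G i x * A i j x * cnj (H j x) \<partial>M) + cnj d * (\<integral>x. G i x * A i j x * cnj (H' j x) \<partial>M)"
      using assms by (simp add: integrable_term)
    finally show ?thesis .
  qed
  then show ?thesis by (simp add: B_def sum.distrib sum_distrib_left)
qed

lemma B_add_add:
  assumes "\<And>i. G i \<in> L2 M" "\<And>i. H i \<in> L2 M"
  shows "B (\<lambda>i x. c * G i x + d * H i x) (\<lambda>i x. c * G i x + d * H i x)
    = c * cnj c * B G G + c * cnj d * B G H + d * cnj c * B H G + d * cnj d * B H H"
  using assms by (simp add: B_linear_left B_linear_right L2_add L2_cmult algebra_simps)

lemma B_diagonal:
  assumes "\<And>i. G i \<in> L2 M"
  shows "integrable M (\<lambda>x. \<Sum>i\<in>UNIV. \<Sum>j\<in>UNIV. G i x * A i j x * cnj (G j x))"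
    and "B G G = (\<integral>x. (\<Sum>i\<in>UNIV. \<Sum>j\<in>UNIV. G i x * A i j x * cnj (G j x)) \<partial>M)"
  using assms by (auto simp: B_def integrable_term Bochner_Integration.integral_sum
      intro!: Bochner_Integration.integrable_sum)

text \<open>The modulus of an integral is at most the integral of the modulus, and the pointwise
  inequality applies with \<xi> = G(x).\<close>

lemma B_sectorial:
  assumes "\<And>i. G i \<in> L2 M" shows "cmod (B G G) \<le> K * Re (B G G)"
proof -
  let ?q = "\<lambda>x. \<Sum>i\<in>UNIV. \<Sum>j\<in>UNIV. G i x * A i j x * cnj (G j x)"
  have "cmod (B G G) \<le> (\<integral>x. cmod (?q x) \<partial>M)"
    unfolding B_diagonal(2)[of G, OF assms] by (rule integral_norm_bound)
  also have "\<dots> \<le> (\<integral>x. K * Re (?q x) \<partial>M)"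
  proof (rule integral_mono_AE)
    show "AE x in M. cmod (?q x) \<le> K * Re (?q x)"
      using sectorial
    proof eventually_elim
      case (elim x)
      from spec[OF this, of "\<lambda>i. G i x"] show ?case .
    qed
  qed (intro integrable_mult_right integrable_Re integrable_norm B_diagonal(1) assms)+
  also have "\<dots> = K * Re (B G G)"
    by (simp only: integral_mult_right_zero integral_Re[OF B_diagonal(1)[of G, OF assms]]
        B_diagonal(2)[of G, OF assms])
  finally show ?thesis .
qed

lemma nonneg_if_sectorial:
  assumes "cmod z \<le> K * r" shows "0 \<le> r"
proof -
  have "0 \<le> K * r" using assms norm_ge_zero[of z] by linarith
  then show ?thesis using K_pos by (simp add: zero_le_mult_iff)
qed

lemma Re_B_nonneg: "(\<And>i. G i \<in> L2 M) \<Longrightarrow> 0 \<le> Re (B G G)"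
  by (rule nonneg_if_sectorial[OF B_sectorial])

text \<open>\<open>B\<close> need not be Hermitian, so the bound comes from polarisation over the
  units 1, -1, i, -i. Each diagonal term is controlled by its real part; in the sum of these the
  mixed terms cancel because the units add up to 0.\<close>

lemma B_bound_sum:
  assumes G: "\<And>i. G i \<in> L2 M" and H: "\<And>i. H i \<in> L2 M"
  shows "cmod (B G H) \<le> K * (Re (B G G) + Re (B H H))"
proof -
  define P where "P c = (\<lambda>i x. 1 * G i x + c * H i x)" for c
  have PL: "P c i \<in> L2 M" for c i
    using G H unfolding P_def by (intro L2_add L2_cmult)
  have P: "B (P c) (P c) = B G G + cnj c * B G H + c * B H G + c * cnj c * B H H" for c
    using B_add_add[of G H, OF G H, of 1 c] by (simp add: P_def)
  have "4 * B G H = B (P 1) (P 1) - B (P (-1)) (P (-1)) + \<i> * B (P \<i>) (P \<i>) - \<i> * B (P (-\<i>)) (P (-\<i>))"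
    by (simp add: P algebra_simps)
  then have eq: "cmod (4 * B G H) = cmod (B (P 1) (P 1) - B (P (-1)) (P (-1)) + \<i> * B (P \<i>) (P \<i>)
      - \<i> * B (P (-\<i>)) (P (-\<i>)))"
    by (rule arg_cong)
  have tri: "cmod (w - x + y - z) \<le> cmod w + cmod x + cmod y + cmod z" for w x y z
    using norm_triangle_ineq4[of "w - x + y" z] norm_triangle_ineq[of "w - x" y]
      norm_triangle_ineq4[of w x] by linarith
  have "4 * cmod (B G H) = cmod (4 * B G H)" by (simp only: norm_mult norm_numeral)
  also have "\<dots> \<le> cmod (B (P 1) (P 1)) + cmod (B (P (-1)) (P (-1)))
      + cmod (\<i> * B (P \<i>) (P \<i>)) + cmod (\<i> * B (P (-\<i>)) (P (-\<i>)))"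
    unfolding eq by (rule tri)
  also have "\<dots> \<le> K * Re (B (P 1) (P 1)) + K * Re (B (P (-1)) (P (-1)))
      + K * Re (B (P \<i>) (P \<i>)) + K * Re (B (P (-\<i>)) (P (-\<i>)))"
    using B_sectorial[of "P _", OF PL] by (auto simp: norm_mult intro!: add_mono)
  also have "\<dots> = 4 * (K * (Re (B G G) + Re (B H H)))"
    by (simp add: P algebra_simps)
  finally show ?thesis by simp
qed

text \<open>Rescaling \<open>G\<close> and \<open>H\<close> in opposite directions turns the sum into a product.\<close>

lemma B_Cauchy_Schwarz:
  assumes G: "\<And>i. G i \<in> L2 M" and H: "\<And>i. H i \<in> L2 M"
  shows "cmod (B G H) \<le> 2 * K * (sqrt (Re (B G G)) * sqrt (Re (B H H)))"
proof (rule le_mult_sqrt_if_le_scaled_sum)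
  fix s :: real assume s: "0 < s"
  \<comment> \<open>With \<open>c\<close> real, the factors \<open>c\<close> and
    \<open>inverse c\<close> cancel in \<open>B G H\<close>, while the diagonal terms are scaled by
    \<open>s\<close> and its inverse.\<close>
  define c where "c = complex_of_real (sqrt s)"
  have c: "c \<noteq> 0" "cnj c = c" "c * c = of_real s"
    using s by (auto simp: c_def simp flip: of_real_mult)
  have scale: "B (\<lambda>i x. d * G' i x) (\<lambda>i x. e * H' i x) = d * cnj e * B G' H'"
    if "\<And>i. G' i \<in> L2 M" "\<And>i. H' i \<in> L2 M" for d e G' H'
    using B_linear_left[of G' G' "\<lambda>i x. e * H' i x" d 0] B_linear_right[of G' H' H' e 0]
      that by (simp add: L2_cmult)
  have "cmod (B (\<lambda>i x. c * G i x) (\<lambda>i x. inverse c * H i x))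
      \<le> K * (Re (B (\<lambda>i x. c * G i x) (\<lambda>i x. c * G i x))
        + Re (B (\<lambda>i x. inverse c * H i x) (\<lambda>i x. inverse c * H i x)))"
    using G H by (intro B_bound_sum L2_cmult)
  also have "B (\<lambda>i x. c * G i x) (\<lambda>i x. inverse c * H i x) = B G H"
    using c by (simp add: scale[of G H, OF G H])
  also have "B (\<lambda>i x. c * G i x) (\<lambda>i x. c * G i x) = of_real s * B G G"
    using c by (simp add: scale[of G G, OF G G])
  also have "B (\<lambda>i x. inverse c * H i x) (\<lambda>i x. inverse c * H i x) = of_real (inverse s) * B H H"
    using c by (simp add: scale[of H H, OF H H] flip: inverse_mult_distrib)
  finally show "cmod (B G H) \<le> K * (s * Re (B G G) + Re (B H H) / s)"
    unfolding Re_of_real_mult by (simp add: divide_inverse mult.commute)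
qed (use assms K_pos Re_B_nonneg in auto)

text \<open>The parallelogram identity, with the nonnegative term of G - H dropped.\<close>

lemma Re_B_add_le:
  assumes G: "\<And>i. G i \<in> L2 M" and H: "\<And>i. H i \<in> L2 M"
  shows "Re (B (\<lambda>i x. G i x + H i x) (\<lambda>i x. G i x + H i x)) \<le> 2 * Re (B G G) + 2 * Re (B H H)"
proof -
  have "0 \<le> Re (B (\<lambda>i x. 1 * G i x + (-1) * H i x) (\<lambda>i x. 1 * G i x + (-1) * H i x))"
    using G H by (intro Re_B_nonneg L2_add L2_cmult)
  then show ?thesis
    using B_add_add[of G H, OF G H, of 1 1] B_add_add[of G H, OF G H, of 1 "-1"] by simp
qed

text \<open>At each point the quadratic form scales by |\<psi>|^2, and its real part is nonnegative,
  so the supremum can be taken out. No lower bound on the coefficients enters.\<close>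

lemma Re_B_mult_le:
  assumes G: "\<And>i. G i \<in> L2 M" and \<psi>: "\<psi> \<in> borel_measurable M" "\<And>x. cmod (\<psi> x) \<le> c"
  shows "Re (B (\<lambda>i x. \<psi> x * G i x) (\<lambda>i x. \<psi> x * G i x)) \<le> c\<^sup>2 * Re (B G G)"
proof -
  let ?q = "\<lambda>x. \<Sum>i\<in>UNIV. \<Sum>j\<in>UNIV. G i x * A i j x * cnj (G j x)"
  let ?r = "\<lambda>x. \<Sum>i\<in>UNIV. \<Sum>j\<in>UNIV. (\<psi> x * G i x) * A i j x * cnj (\<psi> x * G j x)"
  have \<psi>G: "(\<lambda>x. \<psi> x * G i x) \<in> L2 M" for i
    using G \<psi> by (intro L2_mult_bounded[where C = c]) auto
  have "(\<integral>x. Re (?r x) \<partial>M) \<le> (\<integral>x. c\<^sup>2 * Re (?q x) \<partial>M)"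
  proof (rule integral_mono_AE)
    show "AE x in M. Re (?r x) \<le> c\<^sup>2 * Re (?q x)"
      using sectorial
    proof eventually_elim
      case (elim x)
      have "?r x = complex_of_real ((cmod (\<psi> x))\<^sup>2) * ?q x"
        unfolding complex_norm_square by (simp add: sum_distrib_left algebra_simps)
      then have "Re (?r x) = (cmod (\<psi> x))\<^sup>2 * Re (?q x)" by (simp only: Re_of_real_mult)
      moreover have "cmod (?q x) \<le> K * Re (?q x)" using spec[OF elim, of "\<lambda>i. G i x"] .
      then have "0 \<le> Re (?q x)" by (rule nonneg_if_sectorial)
      moreover have "(cmod (\<psi> x))\<^sup>2 \<le> c\<^sup>2" using \<psi>(2) by (intro power_mono) auto
      ultimately show ?case by (simp add: mult_right_mono)
    qed
  qed (intro integrable_mult_right integrable_Re B_diagonal(1)[of G, OF G]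
      B_diagonal(1)[of "\<lambda>i x. \<psi> x * G i x", OF \<psi>G])+
  then show ?thesis
    by (simp only: integral_mult_right_zero integral_Re[OF B_diagonal(1)[of G, OF G]]
        integral_Re[OF B_diagonal(1)[of "\<lambda>i x. \<psi> x * G i x", OF \<psi>G]]
        B_diagonal(2)[of G, OF G] B_diagonal(2)[of "\<lambda>i x. \<psi> x * G i x", OF \<psi>G])
qed

text \<open>Meant for \<eta> the gradient of a test function. The constant collects the bounds of
  \<eta> and of the coefficients and does not depend on \<open>u\<close>.\<close>

lemma Re_B_gradient_le:
  assumes \<eta>: "\<And>i. \<eta> i \<in> borel_measurable M" "\<And>i x. cmod (\<eta> i x) \<le> c i"
  shows "\<exists>C. \<forall>u\<in>L2 M. Re (B (\<lambda>i x. \<eta> i x * u x) (\<lambda>i x. \<eta> i x * u x)) \<le> C * (\<integral>x. (cmod (u x))\<^sup>2 \<partial>M)"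
proof -
  obtain D where D: "\<And>i j. AE x in M. cmod (A i j x) \<le> D i j" using bounded_A by blast
  define C where "C = (\<Sum>i\<in>UNIV. \<Sum>j\<in>UNIV. c i * D i j * c j)"
  have "Re (B (\<lambda>i x. \<eta> i x * u x) (\<lambda>i x. \<eta> i x * u x)) \<le> C * (\<integral>x. (cmod (u x))\<^sup>2 \<partial>M)"
    if u: "u \<in> L2 M" for u
  proof -
    have \<eta>u: "(\<lambda>x. \<eta> i x * u x) \<in> L2 M" for i
      using u \<eta> by (intro L2_mult_bounded[where C = "c i"]) auto
    have "cmod (\<integral>x. (\<eta> i x * u x) * A i j x * cnj (\<eta> j x * u x) \<partial>M)
        \<le> c i * D i j * c j * (\<integral>x. (cmod (u x))\<^sup>2 \<partial>M)" for i j
    proof -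
      have "cmod (\<integral>x. (\<eta> i x * u x) * A i j x * cnj (\<eta> j x * u x) \<partial>M)
          \<le> (\<integral>x. cmod ((\<eta> i x * u x) * A i j x * cnj (\<eta> j x * u x)) \<partial>M)"
        by (rule integral_norm_bound)
      also have "\<dots> \<le> (\<integral>x. c i * D i j * c j * (cmod (u x))\<^sup>2 \<partial>M)"
      proof (rule integral_mono_AE)
        show "AE x in M. cmod ((\<eta> i x * u x) * A i j x * cnj (\<eta> j x * u x))
            \<le> c i * D i j * c j * (cmod (u x))\<^sup>2"
          using D[of i j]
        proof eventually_elim
          case (elim x)
          have "0 \<le> c i" "0 \<le> D i j" using \<eta>(2) elim norm_ge_zero order_trans by blast+
          then have "cmod (\<eta> i x) * cmod (A i j x) * cmod (\<eta> j x) \<le> c i * D i j * c j"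
            using elim \<eta>(2) by (intro mult_mono) auto
          from mult_right_mono[OF this, of "(cmod (u x))\<^sup>2"] show ?case
            by (simp add: norm_mult power2_eq_square mult_ac)
        qed
      qed (use integrable_term[OF \<eta>u \<eta>u] L2_integrable[OF u] in auto)
      also have "\<dots> = c i * D i j * c j * (\<integral>x. (cmod (u x))\<^sup>2 \<partial>M)" by simp
      finally show ?thesis .
    qed
    then have "(\<Sum>i\<in>UNIV. \<Sum>j\<in>UNIV. cmod (\<integral>x. (\<eta> i x * u x) * A i j x * cnj (\<eta> j x * u x) \<partial>M))
        \<le> C * (\<integral>x. (cmod (u x))\<^sup>2 \<partial>M)"
      unfolding C_def sum_distrib_right by (intro sum_mono)
    moreover have "cmod (B (\<lambda>i x. \<eta> i x * u x) (\<lambda>i x. \<eta> i x * u x))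
        \<le> (\<Sum>i\<in>UNIV. \<Sum>j\<in>UNIV. cmod (\<integral>x. (\<eta> i x * u x) * A i j x * cnj (\<eta> j x * u x) \<partial>M))"
      unfolding B_def by (intro sum_norm_le norm_sum)
    moreover have "Re (B (\<lambda>i x. \<eta> i x * u x) (\<lambda>i x. \<eta> i x * u x))
        \<le> cmod (B (\<lambda>i x. \<eta> i x * u x) (\<lambda>i x. \<eta> i x * u x))" by (rule complex_Re_le_cmod)
    ultimately show ?thesis by linarith
  qed
  then show ?thesis by blast
qed

end


subsection \<open>The Neumann form\<close>

locale neumann = sectorial_coefficients "lebesgue_on \<Omega>" A K
  for \<Omega> :: "(real^'d::finite) set" and A :: "'d \<Rightarrow> 'd \<Rightarrow> real^'d \<Rightarrow> complex" and K +
  assumes open_\<Omega>: "open \<Omega>"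
begin

abbreviation grad :: "(real^'d \<Rightarrow> complex) \<Rightarrow> 'd \<Rightarrow> real^'d \<Rightarrow> complex" where
  "grad u i \<equiv> weak_deriv \<Omega> i u"

text \<open>The square of the form norm, for which sums are estimated with the factor 2.\<close>

definition energy :: "(real^'d \<Rightarrow> complex) \<Rightarrow> real" where
  "energy u = Re (B (grad u) (grad u)) + (\<integral>x. (cmod (u x))\<^sup>2 \<partial>lebesgue_on \<Omega>)"

lemma neumann_form_dom: "form_dom (neumann_form \<Omega> A) = H1 \<Omega>"
  by (simp add: neumann_form_def)

lemma neumann_form_val: "form_val (neumann_form \<Omega> A) u v = B (grad u) (grad v)"
  by (simp add: neumann_form_def B_def)

lemma form_norm_neumann: "form_norm (lebesgue_on \<Omega>) (neumann_form \<Omega> A) u = sqrt (energy u)"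
  by (simp add: form_norm_def neumann_form_val energy_def L2_norm_squared)

lemma Re_B_grad_nonneg: "u \<in> H1 \<Omega> \<Longrightarrow> 0 \<le> Re (B (grad u) (grad u))"
  by (intro Re_B_nonneg weak_deriv_L2)

lemma energy_nonneg: "u \<in> H1 \<Omega> \<Longrightarrow> 0 \<le> energy u"
  unfolding energy_def by (intro add_nonneg_nonneg Re_B_grad_nonneg) simp_all

lemma B_grad_cong:
  assumes "u \<in> H1 \<Omega>" "v \<in> H1 \<Omega>"
    and "\<And>i. G i \<in> L2 (lebesgue_on \<Omega>)" "\<And>i. H i \<in> L2 (lebesgue_on \<Omega>)"
    and "\<And>i. AE x in lebesgue_on \<Omega>. grad u i x = G i x" "\<And>i. AE x in lebesgue_on \<Omega>. grad v i x = H i x"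
  shows "B (grad u) (grad v) = B G H"
  using assms by (intro B_cong_AE L2_measurable weak_deriv_L2)

lemma B_grad_linear:
  assumes "u \<in> H1 \<Omega>" "v \<in> H1 \<Omega>"
  shows "B (grad (\<lambda>x. c * u x + d * v x)) (grad (\<lambda>x. c * u x + d * v x))
    = B (\<lambda>i x. c * grad u i x + d * grad v i x) (\<lambda>i x. c * grad u i x + d * grad v i x)"
  using assms
  by (intro B_grad_cong weak_deriv_linear open_\<Omega> H1_linear L2_add L2_cmult weak_deriv_L2)

lemma zero_H1: "(\<lambda>x. 0) \<in> H1 \<Omega>"
  by (rule H1_I[where g = "\<lambda>_ _. 0"]) (simp_all add: is_weak_deriv_def)

lemma H1_cmult: "u \<in> H1 \<Omega> \<Longrightarrow> (\<lambda>x. c * u x) \<in> H1 \<Omega>"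
  using H1_linear[OF open_\<Omega> _ zero_H1, of u c 0] by simp

lemma H1_add: "u \<in> H1 \<Omega> \<Longrightarrow> v \<in> H1 \<Omega> \<Longrightarrow> (\<lambda>x. u x + v x) \<in> H1 \<Omega>"
  using H1_linear[OF open_\<Omega>, of u v 1 1] by simp

lemma H1_diff: "u \<in> H1 \<Omega> \<Longrightarrow> v \<in> H1 \<Omega> \<Longrightarrow> (\<lambda>x. u x - v x) \<in> H1 \<Omega>"
  using H1_linear[OF open_\<Omega>, of u v 1 "-1"] by simp

lemma energy_cmult:
  assumes "u \<in> H1 \<Omega>" shows "energy (\<lambda>x. c * u x) = (cmod c)\<^sup>2 * energy u"
proof -
  have "c * cnj c = of_real ((cmod c)\<^sup>2)" by (metis complex_norm_square)
  then have "B (grad (\<lambda>x. c * u x)) (grad (\<lambda>x. c * u x)) = of_real ((cmod c)\<^sup>2) * B (grad u) (grad u)"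
    using B_grad_linear[OF assms assms, of c 0]
      B_add_add[of "grad u" "grad u" c 0] weak_deriv_L2[OF assms] by simp
  then show ?thesis
    by (simp add: energy_def norm_mult power_mult_distrib distrib_left Re_of_real_mult
        del: of_real_power)
qed

lemma energy_zero: "energy (\<lambda>x. 0) = 0"
  using energy_cmult[OF zero_H1, of 0] by simp

lemma energy_add_le:
  assumes "u \<in> H1 \<Omega>" "v \<in> H1 \<Omega>"
  shows "energy (\<lambda>x. u x + v x) \<le> 2 * energy u + 2 * energy v"
  using B_grad_linear[OF assms, of 1 1] Re_B_add_le[of "grad u" "grad v"]
    integral_cmod_add_squared_le[of u "lebesgue_on \<Omega>" v] assms
  by (simp add: energy_def weak_deriv_L2 H1_L2)

lemma energy_mult_le:
  assumes \<psi>: "\<psi> \<in> test_functions UNIV"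
  shows "\<exists>C\<ge>0. \<forall>u\<in>H1 \<Omega>. energy (\<lambda>x. \<psi> x * u x) \<le> C * energy u"
proof -
  have smooth: "\<psi> \<in> borel_measurable (lebesgue_on \<Omega>)"
      "partial_deriv i \<psi> \<in> borel_measurable (lebesgue_on \<Omega>)" for i
    using test_functionsD(1)[OF \<psi>] test_functionsD(1)[OF test_functions_partial_deriv[OF \<psi>]]
    by (auto intro: smooth_lebesgue_on_measurable)
  obtain c where c: "\<And>x. cmod (\<psi> x) \<le> c" using test_functions_bounded[OF \<psi>] by blast
  have "\<forall>i. \<exists>c. \<forall>x. cmod (partial_deriv i \<psi> x) \<le> c"
    using test_functions_bounded[OF test_functions_partial_deriv[OF \<psi>]] by metis
  then obtain d where d: "\<And>i x. cmod (partial_deriv i \<psi> x) \<le> d i" by metis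
  obtain C where C: "\<And>u. u \<in> L2 (lebesgue_on \<Omega>) \<Longrightarrow>
      Re (B (\<lambda>i x. partial_deriv i \<psi> x * u x) (\<lambda>i x. partial_deriv i \<psi> x * u x))
        \<le> C * (\<integral>x. (cmod (u x))\<^sup>2 \<partial>lebesgue_on \<Omega>)"
    using Re_B_gradient_le[of "\<lambda>i. partial_deriv i \<psi>" d] smooth d by blast
  \<comment> \<open>The gradient part \<psi> grad u contributes 2 c^2 and the part u grad \<psi>
    contributes 2 |C|; the absolute value is there because the sign of \<open>C\<close> is
    unknown.\<close>
  define C' where "C' = 2 * c\<^sup>2 + 2 * \<bar>C\<bar>"
  have "energy (\<lambda>x. \<psi> x * u x) \<le> C' * energy u" if u: "u \<in> H1 \<Omega>" for u
  proof -
    define E I where "E = Re (B (grad u) (grad u))" and "I = (\<integral>x. (cmod (u x))\<^sup>2 \<partial>lebesgue_on \<Omega>)"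
    have EI: "0 \<le> E" "0 \<le> I" using Re_B_grad_nonneg[OF u] by (auto simp: E_def I_def)
    have L2: "(\<lambda>x. \<psi> x * grad u i x) \<in> L2 (lebesgue_on \<Omega>)"
        "(\<lambda>x. partial_deriv i \<psi> x * u x) \<in> L2 (lebesgue_on \<Omega>)" for i
      using u \<psi> by (simp_all add: test_UNIV_mult_L2[OF open_\<Omega>] weak_deriv_L2 H1_L2
          test_functions_partial_deriv)
    have eq: "B (grad (\<lambda>x. \<psi> x * u x)) (grad (\<lambda>x. \<psi> x * u x))
        = B (\<lambda>i x. \<psi> x * grad u i x + partial_deriv i \<psi> x * u x)
            (\<lambda>i x. \<psi> x * grad u i x + partial_deriv i \<psi> x * u x)"
      using u \<psi> L2 by (intro B_grad_cong H1_mult[OF open_\<Omega>] weak_deriv_mult[OF open_\<Omega>] L2_add)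
    have "Re (B (grad (\<lambda>x. \<psi> x * u x)) (grad (\<lambda>x. \<psi> x * u x)))
        \<le> 2 * Re (B (\<lambda>i x. \<psi> x * grad u i x) (\<lambda>i x. \<psi> x * grad u i x))
        + 2 * Re (B (\<lambda>i x. partial_deriv i \<psi> x * u x) (\<lambda>i x. partial_deriv i \<psi> x * u x))"
      unfolding eq using L2 by (intro Re_B_add_le)
    also have "\<dots> \<le> 2 * (c\<^sup>2 * E) + 2 * (C * I)"
      using C[OF H1_L2[OF u]] Re_B_mult_le[of "grad u" \<psi> c, OF weak_deriv_L2[OF u] smooth(1) c]
      by (simp add: E_def I_def)
    finally have "Re (B (grad (\<lambda>x. \<psi> x * u x)) (grad (\<lambda>x. \<psi> x * u x)))
        \<le> 2 * (c\<^sup>2 * E) + 2 * (C * I)" .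
    moreover have "(\<integral>x. (cmod (\<psi> x * u x))\<^sup>2 \<partial>lebesgue_on \<Omega>) \<le> c\<^sup>2 * I"
      unfolding I_def by (rule integral_cmod_mult_squared_le[OF H1_L2[OF u] smooth(1) AE_I2[OF c]])
    ultimately have "energy (\<lambda>x. \<psi> x * u x) \<le> 2 * (c\<^sup>2 * E) + 2 * (C * I) + c\<^sup>2 * I"
      unfolding energy_def by (rule add_mono)
    \<comment> \<open>Nonnegative terms are added so that the right-hand side factors as C' (E +
      I).\<close>
    also have "\<dots> \<le> 2 * (c\<^sup>2 * E) + 2 * (\<bar>C\<bar> * I) + 2 * (c\<^sup>2 * I) + 2 * (\<bar>C\<bar> * E)"
    proof -
      have "C * I \<le> \<bar>C\<bar> * I" by (rule mult_right_mono[OF abs_ge_self EI(2)])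
      moreover have "0 \<le> c\<^sup>2 * I" "0 \<le> \<bar>C\<bar> * E" using EI by simp_all
      ultimately show ?thesis by linarith
    qed
    also have "\<dots> = C' * energy u"
      by (simp add: C'_def energy_def algebra_simps flip: E_def I_def)
    finally show ?thesis .
  qed
  moreover have "0 \<le> C'" by (simp add: C'_def)
  ultimately show ?thesis by blast
qed


subsection \<open>The closure of the Neumann form\<close>

lemma form_Cauchy_const: "v \<in> H1 \<Omega> \<Longrightarrow> form_Cauchy (lebesgue_on \<Omega>) (neumann_form \<Omega> A) (\<lambda>_. v)"
  by (simp add: form_Cauchy_def neumann_form_dom form_norm_neumann energy_zero)

lemma form_approx_const: "v \<in> H1 \<Omega> \<Longrightarrow> form_approx (lebesgue_on \<Omega>) (neumann_form \<Omega> A) (\<lambda>_. v) v"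
  by (simp add: form_approx_def form_Cauchy_const L2_norm_def)

text \<open>Here closability acts: subtracting the fixed \<open>v\<close> preserves the Cauchy
  property, and the differences tend to 0 in L2, hence also in form norm.\<close>

lemma form_approx_energy:
  assumes "closable (lebesgue_on \<Omega>) (neumann_form \<Omega> A)"
    and "form_approx (lebesgue_on \<Omega>) (neumann_form \<Omega> A) U v" and v: "v \<in> H1 \<Omega>"
  shows "U n \<in> H1 \<Omega>" "(\<lambda>n. sqrt (energy (\<lambda>x. U n x - v x))) \<longlonglongrightarrow> 0"
proof -
  have U: "U n \<in> H1 \<Omega>" for n
    using assms(2) by (simp add: form_approx_def form_Cauchy_def neumann_form_dom)
  then show "U n \<in> H1 \<Omega>" .
  have "form_Cauchy (lebesgue_on \<Omega>) (neumann_form \<Omega> A) (\<lambda>n x. U n x - v x)"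
    using assms(2) U v by (simp add: form_approx_def form_Cauchy_def neumann_form_dom H1_diff)
  then show "(\<lambda>n. sqrt (energy (\<lambda>x. U n x - v x))) \<longlonglongrightarrow> 0"
    using assms(1,2) by (auto simp: closable_def form_approx_def simp flip: form_norm_neumann)
qed

text \<open>Writing U = W + v and V = Z + v, all terms but \<open>B (grad v) (grad v)\<close>
  contain \<open>W\<close> or \<open>Z\<close>, and Cauchy-Schwarz sends them to 0.\<close>

lemma neumann_form_tendsto:
  assumes cl: "closable (lebesgue_on \<Omega>) (neumann_form \<Omega> A)"
    and U: "form_approx (lebesgue_on \<Omega>) (neumann_form \<Omega> A) U v"
    and V: "form_approx (lebesgue_on \<Omega>) (neumann_form \<Omega> A) V v" and v: "v \<in> H1 \<Omega>"
  shows "(\<lambda>n. B (grad (U n)) (grad (V n))) \<longlonglongrightarrow> B (grad v) (grad v)"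
proof -
  note H1 = form_approx_energy(1)[OF cl U v] form_approx_energy(1)[OF cl V v]
  define W Z where "W n = (\<lambda>x. U n x - v x)" and "Z n = (\<lambda>x. V n x - v x)" for n
  have WZ: "W n \<in> H1 \<Omega>" "Z n \<in> H1 \<Omega>" for n
    unfolding W_def Z_def using H1 v by (auto intro: H1_diff)
  have E: "(\<lambda>n. sqrt (Re (B (grad (Y n)) (grad (Y n))))) \<longlonglongrightarrow> 0"
    if "(\<lambda>n. sqrt (energy (Y n))) \<longlonglongrightarrow> 0" "\<And>n. Y n \<in> H1 \<Omega>" for Y
    using that(1)
    by (rule Lim_null_comparison[rotated], intro always_eventually allI)
      (simp add: energy_def Re_B_grad_nonneg that(2))
  have W: "(\<lambda>n. sqrt (Re (B (grad (W n)) (grad (W n))))) \<longlonglongrightarrow> 0"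
    using form_approx_energy(2)[OF cl U v] WZ by (intro E) (simp_all add: W_def)
  have Z: "(\<lambda>n. sqrt (Re (B (grad (Z n)) (grad (Z n))))) \<longlonglongrightarrow> 0"
    using form_approx_energy(2)[OF cl V v] WZ by (intro E) (simp_all add: Z_def)
  note L2 = weak_deriv_L2[OF WZ(1)] weak_deriv_L2[OF WZ(2)] weak_deriv_L2[OF v]
  have conv: "(\<lambda>n. B (grad (X n)) (grad (Y n))) \<longlonglongrightarrow> 0"
    if "(\<lambda>n. sqrt (Re (B (grad (X n)) (grad (X n)))) * sqrt (Re (B (grad (Y n)) (grad (Y n))))) \<longlonglongrightarrow> 0"
      "\<And>n. X n \<in> H1 \<Omega>" "\<And>n. Y n \<in> H1 \<Omega>" for X Y
    using tendsto_mult_right_zero[OF that(1), of "2 * K"]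
    by (rule Lim_null_comparison[rotated], intro always_eventually allI)
      (intro B_Cauchy_Schwarz weak_deriv_L2 that)
  have "B (grad (U n)) (grad (V n)) = B (grad (W n)) (grad (Z n)) + B (grad (W n)) (grad v)
      + B (grad v) (grad (Z n)) + B (grad v) (grad v)" for n
  proof -
    have lin: "AE x in lebesgue_on \<Omega>. grad X i x = 1 * grad Y i x + 1 * grad v i x"
      if "Y \<in> H1 \<Omega>" "X = (\<lambda>x. 1 * Y x + 1 * v x)" for X Y i
      unfolding that(2) by (rule weak_deriv_linear[OF open_\<Omega> that(1) v])
    have "B (grad (U n)) (grad (V n)) = B (\<lambda>i x. 1 * grad (W n) i x + 1 * grad v i x)
        (\<lambda>i x. 1 * grad (Z n) i x + 1 * grad v i x)"
      using H1 WZ L2 by (intro B_grad_cong L2_add L2_cmult lin) (simp_all add: W_def Z_def)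
    also have "\<dots> = 1 * B (grad (W n)) (\<lambda>i x. 1 * grad (Z n) i x + 1 * grad v i x)
        + 1 * B (grad v) (\<lambda>i x. 1 * grad (Z n) i x + 1 * grad v i x)"
      using L2 by (intro B_linear_left L2_add L2_cmult)
    also have "B (grad (W n)) (\<lambda>i x. 1 * grad (Z n) i x + 1 * grad v i x)
        = cnj 1 * B (grad (W n)) (grad (Z n)) + cnj 1 * B (grad (W n)) (grad v)"
      using L2 by (intro B_linear_right)
    also have "B (grad v) (\<lambda>i x. 1 * grad (Z n) i x + 1 * grad v i x)
        = cnj 1 * B (grad v) (grad (Z n)) + cnj 1 * B (grad v) (grad v)"
      using L2 by (intro B_linear_right)
    finally show ?thesis by simp
  qed
  moreover have "(\<lambda>n. B (grad (W n)) (grad (Z n)) + B (grad (W n)) (grad v)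
      + B (grad v) (grad (Z n)) + B (grad v) (grad v)) \<longlonglongrightarrow> 0 + 0 + 0 + B (grad v) (grad v)"
    using WZ v tendsto_mult[OF W Z] tendsto_mult_left_zero[OF W] tendsto_mult_right_zero[OF Z]
    by (intro tendsto_add conv tendsto_const) simp_all
  ultimately show ?thesis by simp
qed

text \<open>The closure is defined by a unique limit over all approximating sequences.
  \<open>neumann_form_tendsto\<close> shows that the candidate is such a limit; the constant
  sequence \<open>v\<close> excludes any other.\<close>

lemma form_norm_closure:
  assumes cl: "closable (lebesgue_on \<Omega>) (neumann_form \<Omega> A)" and v: "v \<in> H1 \<Omega>"
  shows "form_norm (lebesgue_on \<Omega>) (form_closure (lebesgue_on \<Omega>) (neumann_form \<Omega> A)) v
    = sqrt (energy v)"
proof -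
  have "form_val (form_closure (lebesgue_on \<Omega>) (neumann_form \<Omega> A)) v v = B (grad v) (grad v)"
    unfolding form_closure_def neumann_form_val form.select_convs
  proof (rule the_equality)
    show "\<forall>U V. form_approx (lebesgue_on \<Omega>) (neumann_form \<Omega> A) U v \<longrightarrow>
        form_approx (lebesgue_on \<Omega>) (neumann_form \<Omega> A) V v \<longrightarrow>
        (\<lambda>n. B (grad (U n)) (grad (V n))) \<longlonglongrightarrow> B (grad v) (grad v)"
      using neumann_form_tendsto[OF cl _ _ v] by blast
  next
    fix z
    assume "\<forall>U V. form_approx (lebesgue_on \<Omega>) (neumann_form \<Omega> A) U v \<longrightarrow>
        form_approx (lebesgue_on \<Omega>) (neumann_form \<Omega> A) V v \<longrightarrow>
        (\<lambda>n. B (grad (U n)) (grad (V n))) \<longlonglongrightarrow> z"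
    then have "(\<lambda>n::nat. B (grad v) (grad v)) \<longlonglongrightarrow> z" using form_approx_const[OF v] by blast
    then show "z = B (grad v) (grad v)" by (simp add: LIMSEQ_const_iff)
  qed
  then show ?thesis by (simp add: form_norm_def energy_def L2_norm_squared)
qed

lemma zero_in_form_closure:
  "(\<lambda>x. 0) \<in> form_dom (form_closure (lebesgue_on \<Omega>) (neumann_form \<Omega> A))"
  using form_approx_const[OF zero_H1] by (auto simp: form_closure_def)

end


subsection \<open>Traces of zero\<close>

locale robin = neumann \<Omega> A K
  for \<Omega> :: "(real^'d::finite) set" and A :: "'d \<Rightarrow> 'd \<Rightarrow> real^'d \<Rightarrow> complex" and K +
  fixes \<mu> :: "(real^'d) measure"
  assumes sets_\<mu>: "sets \<mu> = sets (restrict_space borel (frontier \<Omega>))"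
    and finite_\<mu>: "\<And>C. compact C \<Longrightarrow> C \<subseteq> frontier \<Omega> \<Longrightarrow> emeasure \<mu> C < \<infinity>"
    and closable: "closable (lebesgue_on \<Omega>) (neumann_form \<Omega> A)"
begin

lemma space_\<mu>: "space \<mu> = frontier \<Omega>"
  using sets_eq_imp_space_eq[OF sets_\<mu>] by (simp add: space_restrict_space)

lemma sets_\<mu>_iff: "C \<in> sets \<mu> \<longleftrightarrow> C \<in> sets borel \<and> C \<subseteq> frontier \<Omega>"
  by (simp add: sets_\<mu> sets_restrict_space_iff conj_commute)

lemma sigma_finite_\<mu>: "sigma_finite_measure \<mu>"
proof
  \<comment> \<open>The frontier is closed, so closed balls cut it into compact pieces, on which
    \<mu> is finite.\<close>
  define C where "C = (\<lambda>n::nat. frontier \<Omega> \<inter> cball 0 (real n))"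
  have C: "compact (C n)" "C n \<subseteq> frontier \<Omega>" for n
    by (auto simp: C_def intro: closed_Int_compact)
  have "\<exists>n. x \<in> C n" if "x \<in> frontier \<Omega>" for x
    using real_arch_simple[of "norm x"] that by (auto simp: C_def)
  then have "\<Union>(range C) = space \<mu>" using C(2) by (auto simp: space_\<mu>)
  moreover have "range C \<subseteq> sets \<mu>" using C by (auto simp: sets_\<mu>_iff borel_compact)
  moreover have "\<forall>c\<in>range C. emeasure \<mu> c \<noteq> \<infinity>" using finite_\<mu> C by (auto simp: less_top)
  ultimately show "\<exists>S. countable S \<and> S \<subseteq> sets \<mu> \<and> \<Union>S = space \<mu> \<and> (\<forall>a\<in>S. emeasure \<mu> a \<noteq> \<infinity>)"
    by (intro exI[of _ "range C"]) auto
qed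

lemma continuous_measurable_\<mu>:
  assumes "continuous_on (closure \<Omega>) u" shows "u \<in> borel_measurable \<mu>"
proof -
  have "continuous_on (frontier \<Omega>) u"
    using assms by (rule continuous_on_subset) (simp add: frontier_def)
  then have "u \<in> borel_measurable (restrict_space borel (frontier \<Omega>))"
    by (rule borel_measurable_continuous_on_restrict)
  then show ?thesis by (simp cong: measurable_cong_sets add: sets_\<mu>)
qed

lemma robin_form_dom_iff:
  "u \<in> form_dom (robin_form \<Omega> A \<mu>) \<longleftrightarrow> u \<in> H1 \<Omega> \<and> continuous_on (closure \<Omega>) u \<and> u \<in> L2 \<mu>"
proof -
  have "u \<in> L2 \<mu> \<longleftrightarrow> (\<integral>\<^sup>+x. ennreal ((cmod (u x))\<^sup>2) \<partial>\<mu>) < \<infinity>" if "continuous_on (closure \<Omega>) u"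
  proof -
    have [measurable]: "u \<in> borel_measurable \<mu>" by (rule continuous_measurable_\<mu>[OF that])
    show ?thesis by (simp add: L2_def integrable_iff_bounded)
  qed
  then show ?thesis by (auto simp: robin_form_def)
qed

lemma robin_form_dom_zero: "(\<lambda>x. 0) \<in> form_dom (robin_form \<Omega> A \<mu>)"
  by (simp add: robin_form_dom_iff zero_H1)

lemma robin_form_dom_add:
  "u \<in> form_dom (robin_form \<Omega> A \<mu>) \<Longrightarrow> v \<in> form_dom (robin_form \<Omega> A \<mu>) \<Longrightarrow>
    (\<lambda>x. u x + v x) \<in> form_dom (robin_form \<Omega> A \<mu>)"
  by (simp add: robin_form_dom_iff H1_add L2_add continuous_on_add)

lemma robin_form_dom_cmult:
  "u \<in> form_dom (robin_form \<Omega> A \<mu>) \<Longrightarrow> (\<lambda>x. c * u x) \<in> form_dom (robin_form \<Omega> A \<mu>)"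
  by (simp add: robin_form_dom_iff H1_cmult L2_cmult continuous_on_mult_left)

lemma smooth_measurable_\<mu>: "f \<in> smooth_functions \<Longrightarrow> f \<in> borel_measurable \<mu>"
  by (intro continuous_measurable_\<mu> smooth_continuous_on)

lemma test_mult_L2_\<mu>:
  assumes "\<psi> \<in> test_functions UNIV" "u \<in> L2 \<mu>" shows "(\<lambda>x. \<psi> x * u x) \<in> L2 \<mu>"
proof -
  obtain C where "\<And>x. cmod (\<psi> x) \<le> C" using test_functions_bounded[OF assms(1)] by blast
  then show ?thesis
    using assms smooth_measurable_\<mu>[OF test_functionsD(1)[OF assms(1)]]
    by (intro L2_mult_bounded[where C = C]) auto
qed

lemma robin_form_dom_mult:
  assumes "\<psi> \<in> test_functions UNIV" "u \<in> form_dom (robin_form \<Omega> A \<mu>)"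
  shows "(\<lambda>x. \<psi> x * u x) \<in> form_dom (robin_form \<Omega> A \<mu>)"
  using assms smooth_continuous_on[OF test_functionsD(1)[OF assms(1)]]
  by (simp add: robin_form_dom_iff H1_mult[OF open_\<Omega>] test_mult_L2_\<mu> continuous_on_mult)

text \<open>Replacing sequences by approximation within \<open>e\<close> makes the subspace axioms,
  and closedness in particular, direct to check.\<close>

definition zero_traces :: "(real^'d \<Rightarrow> complex) set" where
  "zero_traces = {\<phi> \<in> L2 \<mu>. \<forall>e>0. \<exists>u\<in>form_dom (robin_form \<Omega> A \<mu>).
      energy u < e \<and> (\<integral>x. (cmod (u x - \<phi> x))\<^sup>2 \<partial>\<mu>) < e}"

lemma is_trace_zero_iff:
  assumes \<phi>: "\<phi> \<in> L2 \<mu>"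
  shows "is_trace \<Omega> A \<mu> \<phi> (\<lambda>x. 0) \<longleftrightarrow> \<phi> \<in> zero_traces"
proof -
  let ?D = "form_dom (robin_form \<Omega> A \<mu>)"
  have norms: "form_norm (lebesgue_on \<Omega>) (form_closure (lebesgue_on \<Omega>) (neumann_form \<Omega> A)) u
      = sqrt (energy u)" if "u \<in> ?D" for u
    using that closable by (simp add: form_norm_closure robin_form_dom_iff)
  have pos: "0 \<le> energy u" if "u \<in> ?D" for u
    using that by (simp add: energy_nonneg robin_form_dom_iff)
  have iff: "is_trace \<Omega> A \<mu> \<phi> (\<lambda>x. 0) \<longleftrightarrow> (\<exists>U. (\<forall>n. U n \<in> ?D) \<and>
      (\<lambda>n. sqrt (energy (U n))) \<longlonglongrightarrow> 0 \<and> (\<lambda>n. L2_norm \<mu> (\<lambda>x. U n x - \<phi> x)) \<longlonglongrightarrow> 0)"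
    using \<phi> zero_in_form_closure norms by (auto simp: is_trace_def cong: conj_cong)
  show ?thesis
  proof
    assume "is_trace \<Omega> A \<mu> \<phi> (\<lambda>x. 0)"
    then obtain U where U: "\<And>n. U n \<in> ?D" "(\<lambda>n. sqrt (energy (U n))) \<longlonglongrightarrow> 0"
        "(\<lambda>n. L2_norm \<mu> (\<lambda>x. U n x - \<phi> x)) \<longlonglongrightarrow> 0"
      using iff by blast
    have "(\<lambda>n. (sqrt (energy (U n)))\<^sup>2) \<longlonglongrightarrow> 0\<^sup>2" "(\<lambda>n. (L2_norm \<mu> (\<lambda>x. U n x - \<phi> x))\<^sup>2) \<longlonglongrightarrow> 0\<^sup>2"
      using U(2,3) by (auto intro!: tendsto_power)
    then have lim: "(\<lambda>n. energy (U n)) \<longlonglongrightarrow> 0" "(\<lambda>n. \<integral>x. (cmod (U n x - \<phi> x))\<^sup>2 \<partial>\<mu>) \<longlonglongrightarrow> 0"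
      using pos[OF U(1)] by (simp_all add: L2_norm_squared)
    have "\<exists>u\<in>?D. energy u < e \<and> (\<integral>x. (cmod (u x - \<phi> x))\<^sup>2 \<partial>\<mu>) < e" if "0 < e" for e
    proof -
      have "eventually (\<lambda>n. energy (U n) < e \<and> (\<integral>x. (cmod (U n x - \<phi> x))\<^sup>2 \<partial>\<mu>) < e) sequentially"
        using order_tendstoD(2)[OF lim(1) that] order_tendstoD(2)[OF lim(2) that]
        by (rule eventually_conj)
      then obtain n where "energy (U n) < e" "(\<integral>x. (cmod (U n x - \<phi> x))\<^sup>2 \<partial>\<mu>) < e"
        by (auto simp: eventually_sequentially)
      then show ?thesis using U(1) by blast
    qed
    then show "\<phi> \<in> zero_traces" using \<phi> by (simp add: zero_traces_def)
  next
    assume "\<phi> \<in> zero_traces"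
    \<comment> \<open>The sequence is chosen with errors 1 / (n + 1), which are positive from the
      first index on.\<close>
    then have "\<forall>n. \<exists>u\<in>?D. energy u < inverse (real (Suc n))
        \<and> (\<integral>x. (cmod (u x - \<phi> x))\<^sup>2 \<partial>\<mu>) < inverse (real (Suc n))"
      by (simp add: zero_traces_def)
    then obtain U where U: "\<And>n. U n \<in> ?D" "\<And>n. energy (U n) < inverse (real (Suc n))"
        "\<And>n. (\<integral>x. (cmod (U n x - \<phi> x))\<^sup>2 \<partial>\<mu>) < inverse (real (Suc n))"
      by metis
    have squeeze: "(\<lambda>n. sqrt (f n)) \<longlonglongrightarrow> 0"
      if "\<And>n. 0 \<le> f n" "\<And>n. f n < inverse (real (Suc n))" for f
    proof -
      have "f \<longlonglongrightarrow> 0"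
        using that less_imp_le
        by (intro tendsto_sandwich[OF _ _ tendsto_const LIMSEQ_inverse_real_of_nat])
          (auto intro!: always_eventually simp del: of_nat_Suc)
      from tendsto_real_sqrt[OF this] show ?thesis by simp
    qed
    have "(\<lambda>n. sqrt (energy (U n))) \<longlonglongrightarrow> 0" by (rule squeeze[OF pos[OF U(1)] U(2)])
    moreover have "(\<lambda>n. L2_norm \<mu> (\<lambda>x. U n x - \<phi> x)) \<longlonglongrightarrow> 0"
      unfolding L2_norm_def using U by (intro squeeze) simp_all
    ultimately show "is_trace \<Omega> A \<mu> \<phi> (\<lambda>x. 0)" using iff U(1) by blast
  qed
qed

lemma zero_tracesE:
  assumes "\<phi> \<in> zero_traces" "0 < e"
  obtains u where "u \<in> form_dom (robin_form \<Omega> A \<mu>)" "u \<in> H1 \<Omega>" "(\<lambda>x. u x - \<phi> x) \<in> L2 \<mu>"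
    "energy u < e" "(\<integral>x. (cmod (u x - \<phi> x))\<^sup>2 \<partial>\<mu>) < e"
  using assms by (fastforce simp: zero_traces_def robin_form_dom_iff intro: L2_diff)

text \<open>Absorbs the constants of the estimates by passing to e / (C + 1); adding 1 covers
  \<open>C = 0\<close> and makes the inequality strict.\<close>

lemma zero_tracesI_le:
  assumes "\<phi> \<in> L2 \<mu>" "0 \<le> C"
    and "\<And>e. 0 < e \<Longrightarrow> \<exists>u\<in>form_dom (robin_form \<Omega> A \<mu>).
      energy u \<le> C * e \<and> (\<integral>x. (cmod (u x - \<phi> x))\<^sup>2 \<partial>\<mu>) \<le> C * e"
  shows "\<phi> \<in> zero_traces"
proof -
  have "\<exists>u\<in>form_dom (robin_form \<Omega> A \<mu>). energy u < e \<and> (\<integral>x. (cmod (u x - \<phi> x))\<^sup>2 \<partial>\<mu>) < e"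
    if "0 < e" for e
  proof -
    have "C * (e / (C + 1)) < e" "0 < e / (C + 1)" using assms(2) that by (auto simp: field_simps)
    then show ?thesis using assms(3)[of "e / (C + 1)"] by (meson le_less_trans)
  qed
  then show ?thesis using assms(1) by (simp add: zero_traces_def)
qed

sublocale zero_traces: L2_closed_subspace \<mu> zero_traces
proof
  show "zero_traces \<subseteq> L2 \<mu>" by (auto simp: zero_traces_def)
  show "(\<lambda>x. 0) \<in> zero_traces"
    using robin_form_dom_zero energy_zero by (force simp: zero_traces_def)
next
  fix \<phi> \<eta> assume \<phi>\<eta>: "\<phi> \<in> zero_traces" "\<eta> \<in> zero_traces"
  show "(\<lambda>x. \<phi> x + \<eta> x) \<in> zero_traces"
  \<comment> \<open>4 = 2 + 2, from the factor 2 in front of each of the two squared errors.\<close>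
  proof (rule zero_tracesI_le[where C = 4])
    show "(\<lambda>x. \<phi> x + \<eta> x) \<in> L2 \<mu>" using \<phi>\<eta> by (auto simp: zero_traces_def intro: L2_add)
    fix e :: real assume e: "0 < e"
    obtain u where u: "u \<in> form_dom (robin_form \<Omega> A \<mu>)" "u \<in> H1 \<Omega>" "(\<lambda>x. u x - \<phi> x) \<in> L2 \<mu>"
        "energy u < e" "(\<integral>x. (cmod (u x - \<phi> x))\<^sup>2 \<partial>\<mu>) < e"
      by (rule zero_tracesE[OF \<phi>\<eta>(1) e])
    obtain v where v: "v \<in> form_dom (robin_form \<Omega> A \<mu>)" "v \<in> H1 \<Omega>" "(\<lambda>x. v x - \<eta> x) \<in> L2 \<mu>"
        "energy v < e" "(\<integral>x. (cmod (v x - \<eta> x))\<^sup>2 \<partial>\<mu>) < e"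
      by (rule zero_tracesE[OF \<phi>\<eta>(2) e])
    have "energy (\<lambda>x. u x + v x) \<le> 4 * e" using energy_add_le[OF u(2) v(2)] u(4) v(4) by simp
    moreover have "(\<integral>x. (cmod (u x + v x - (\<phi> x + \<eta> x)))\<^sup>2 \<partial>\<mu>) \<le> 4 * e"
      using integral_cmod_add_squared_le[OF u(3) v(3)] u(5) v(5) by (simp add: algebra_simps)
    ultimately show "\<exists>u\<in>form_dom (robin_form \<Omega> A \<mu>). energy u \<le> 4 * e
        \<and> (\<integral>x. (cmod (u x - (\<phi> x + \<eta> x)))\<^sup>2 \<partial>\<mu>) \<le> 4 * e"
      using robin_form_dom_add[OF u(1) v(1)] by blast
  qed simp
next
  fix \<phi> c assume \<phi>: "\<phi> \<in> zero_traces"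
  show "(\<lambda>x. c * \<phi> x) \<in> zero_traces"
  proof (rule zero_tracesI_le[where C = "(cmod c)\<^sup>2"])
    show "(\<lambda>x. c * \<phi> x) \<in> L2 \<mu>" using \<phi> by (auto simp: zero_traces_def intro: L2_cmult)
    fix e :: real assume e: "0 < e"
    obtain u where u: "u \<in> form_dom (robin_form \<Omega> A \<mu>)" "u \<in> H1 \<Omega>" "(\<lambda>x. u x - \<phi> x) \<in> L2 \<mu>"
        "energy u < e" "(\<integral>x. (cmod (u x - \<phi> x))\<^sup>2 \<partial>\<mu>) < e"
      by (rule zero_tracesE[OF \<phi> e])
    have "energy (\<lambda>x. c * u x) \<le> (cmod c)\<^sup>2 * e"
      using u by (simp add: energy_cmult mult_left_mono)
    moreover have "(\<integral>x. (cmod (c * u x - c * \<phi> x))\<^sup>2 \<partial>\<mu>) \<le> (cmod c)\<^sup>2 * e"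
      using u(5) by (simp add: norm_mult power_mult_distrib mult_left_mono flip: right_diff_distrib)
    ultimately show "\<exists>u\<in>form_dom (robin_form \<Omega> A \<mu>). energy u \<le> (cmod c)\<^sup>2 * e
        \<and> (\<integral>x. (cmod (u x - c * \<phi> x))\<^sup>2 \<partial>\<mu>) \<le> (cmod c)\<^sup>2 * e"
      using robin_form_dom_cmult[OF u(1)] by blast
  qed simp
next
  fix \<phi> assume \<phi>: "\<phi> \<in> L2 \<mu>"
    and approx: "\<And>e. 0 < e \<Longrightarrow> \<exists>\<eta>\<in>zero_traces. (\<integral>x. (cmod (\<eta> x - \<phi> x))\<^sup>2 \<partial>\<mu>) < e"
  show "\<phi> \<in> zero_traces"
  \<comment> \<open>A function \<open>u\<close> for the nearby \<eta> also serves for \<phi>: only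
    its boundary error grows, to at most 2 e + 2 e, while its energy stays below e.\<close>
  proof (rule zero_tracesI_le[where C = 4])
    fix e :: real assume e: "0 < e"
    obtain \<eta> where \<eta>: "\<eta> \<in> zero_traces" "(\<integral>x. (cmod (\<eta> x - \<phi> x))\<^sup>2 \<partial>\<mu>) < e"
      using approx[OF e] by blast
    obtain u where u: "u \<in> form_dom (robin_form \<Omega> A \<mu>)" "u \<in> H1 \<Omega>" "(\<lambda>x. u x - \<eta> x) \<in> L2 \<mu>"
        "energy u < e" "(\<integral>x. (cmod (u x - \<eta> x))\<^sup>2 \<partial>\<mu>) < e"
      by (rule zero_tracesE[OF \<eta>(1) e])
    have "(\<lambda>x. \<eta> x - \<phi> x) \<in> L2 \<mu>" using \<eta> \<phi> by (auto simp: zero_traces_def intro: L2_diff)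
    from integral_cmod_add_squared_le[OF u(3) this]
    have "(\<integral>x. (cmod (u x - \<phi> x))\<^sup>2 \<partial>\<mu>) \<le> 4 * e" using u(5) \<eta>(2) by simp
    then show "\<exists>u\<in>form_dom (robin_form \<Omega> A \<mu>). energy u \<le> 4 * e
        \<and> (\<integral>x. (cmod (u x - \<phi> x))\<^sup>2 \<partial>\<mu>) \<le> 4 * e"
      using u(1,4) e by (intro bexI[of _ u]) auto
  qed (use \<phi> in auto)
qed

lemma zero_traces_mult:
  assumes \<psi>: "\<psi> \<in> test_functions UNIV" and \<phi>: "\<phi> \<in> zero_traces"
  shows "(\<lambda>x. \<psi> x * \<phi> x) \<in> zero_traces"
proof -
  obtain C where C: "0 \<le> C" "\<And>u. u \<in> H1 \<Omega> \<Longrightarrow> energy (\<lambda>x. \<psi> x * u x) \<le> C * energy u"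
    using energy_mult_le[OF \<psi>] by blast
  obtain c where c: "\<And>x. cmod (\<psi> x) \<le> c" using test_functions_bounded[OF \<psi>] by blast
  show ?thesis
  \<comment> \<open>One constant for both requirements: \<open>C\<close> bounds the energy, c^2 the
    error on the boundary, and both are nonnegative.\<close>
  proof (rule zero_tracesI_le[where C = "C + c\<^sup>2"])
    show "(\<lambda>x. \<psi> x * \<phi> x) \<in> L2 \<mu>" using \<phi> \<psi> by (auto simp: zero_traces_def intro: test_mult_L2_\<mu>)
    fix e :: real assume e: "0 < e"
    obtain u where u: "u \<in> form_dom (robin_form \<Omega> A \<mu>)" "u \<in> H1 \<Omega>" "(\<lambda>x. u x - \<phi> x) \<in> L2 \<mu>"
        "energy u < e" "(\<integral>x. (cmod (u x - \<phi> x))\<^sup>2 \<partial>\<mu>) < e"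
      by (rule zero_tracesE[OF \<phi> e])
    have le: "C * e \<le> (C + c\<^sup>2) * e" "c\<^sup>2 * e \<le> (C + c\<^sup>2) * e"
      using C(1) e by (auto intro!: mult_right_mono)
    have "energy (\<lambda>x. \<psi> x * u x) \<le> C * e"
      using C(2)[OF u(2)] mult_left_mono[OF less_imp_le[OF u(4)] C(1)] by linarith
    moreover have "(\<integral>x. (cmod (\<psi> x * u x - \<psi> x * \<phi> x))\<^sup>2 \<partial>\<mu>) \<le> c\<^sup>2 * e"
      using integral_cmod_mult_squared_le[OF u(3) smooth_measurable_\<mu>[OF test_functionsD(1)[OF \<psi>]]
          AE_I2[OF c]] mult_left_mono[OF less_imp_le[OF u(5)] zero_le_power2, of c]
      by (simp add: right_diff_distrib)
    ultimately show "\<exists>u\<in>form_dom (robin_form \<Omega> A \<mu>). energy u \<le> (C + c\<^sup>2) * e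
        \<and> (\<integral>x. (cmod (u x - \<psi> x * \<phi> x))\<^sup>2 \<partial>\<mu>) \<le> (C + c\<^sup>2) * e"
      using robin_form_dom_mult[OF \<psi> u(1)] le by (blast intro: order_trans)
  qed (use C in simp)
qed

lemma zero_traces_indicator_box:
  assumes "\<phi> \<in> zero_traces" shows "(\<lambda>x. indicator (box a b) x * \<phi> x) \<in> zero_traces"
proof (rule zero_traces.closed_dominated)
  show "(\<lambda>x. bump a b n x * \<phi> x) \<in> zero_traces" for n
    by (rule zero_traces_mult[OF bump_test_function assms]) simp
  show \<phi>: "\<phi> \<in> L2 \<mu>" using assms zero_traces.subset by blast
  have "box a b \<inter> space \<mu> \<in> sets \<mu>"
    by (simp add: sets_\<mu>_iff space_\<mu> borel_closed sets.Int)
  then show "(\<lambda>x. indicator (box a b) x * \<phi> x) \<in> borel_measurable \<mu>"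
    using L2_measurable[OF \<phi>] by (intro borel_measurable_times) (auto simp: borel_measurable_indicator_iff)
  show "AE x in \<mu>. cmod (bump a b n x * \<phi> x) \<le> 1 * cmod (\<phi> x)" for n
    using bump_le_1[of a b n] by (intro AE_I2) (simp add: norm_mult mult_left_le_one_le)
  show "AE x in \<mu>. (\<lambda>n. bump a b n x * \<phi> x) \<longlonglongrightarrow> indicator (box a b) x * \<phi> x"
    by (intro AE_I2 tendsto_intros bump_tendsto_indicator)
qed

lemma L2_closed_ideal_zero_traces: "L2_closed_ideal \<mu> zero_traces"
proof -
  interpret sigma_finite_measure \<mu> by (rule sigma_finite_\<mu>)
  let ?G = "range (\<lambda>(c, d). box c d :: (real^'d) set)"
  have borel: "sets (borel :: (real^'d) measure) = sigma_sets UNIV ?G"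
    unfolding borel_eq_box by simp
  show ?thesis
  proof
    fix C \<phi> assume C: "C \<in> sets \<mu>" and \<phi>: "\<phi> \<in> zero_traces"
    show "(\<lambda>x. indicator C x * \<phi> x) \<in> zero_traces"
    \<comment> \<open>Boxes of the whole space are used as generators: sets measurable for \<mu> are
      Borel in the whole space because the frontier is closed.\<close>
    proof (rule zero_traces.indicator_sigma_sets[of ?G])
      show "D \<inter> space \<mu> \<in> sets \<mu>" if "D \<in> sigma_sets UNIV ?G" for D
        using that unfolding borel[symmetric] by (simp add: sets_\<mu>_iff space_\<mu> borel_closed sets.Int)
      show "(\<lambda>x. indicator D x * f x) \<in> zero_traces" if "D \<in> ?G" "f \<in> zero_traces" for D f
        using that zero_traces_indicator_box by auto
      show "C \<in> sigma_sets UNIV ?G" using C unfolding borel[symmetric] by (simp add: sets_\<mu>_iff)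
    qed (use \<phi> in auto)
  qed
qed

theorem zero_traces_eq:
  "\<exists>\<Gamma>a. \<Gamma>a \<in> sets borel \<and> \<Gamma>a \<subseteq> frontier \<Omega> \<and>
    {\<phi> \<in> L2 \<mu>. is_trace \<Omega> A \<mu> \<phi> (\<lambda>x. 0)} = {\<phi> \<in> L2 \<mu>. AE x in \<mu>. x \<in> \<Gamma>a \<longrightarrow> \<phi> x = 0}"
proof -
  interpret ideal: L2_closed_ideal \<mu> zero_traces by (rule L2_closed_ideal_zero_traces)
  obtain C where C: "C \<in> sets \<mu>" and eq: "zero_traces = {f \<in> L2 \<mu>. AE x in \<mu>. x \<notin> C \<longrightarrow> f x = 0}"
    using ideal.eq_vanishing_off by blast
  have "{\<phi> \<in> L2 \<mu>. is_trace \<Omega> A \<mu> \<phi> (\<lambda>x. 0)} = {\<phi> \<in> L2 \<mu>. \<phi> \<in> zero_traces}"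
    using is_trace_zero_iff by blast
  \<comment> \<open>\<open>C\<close> carries the zero traces, so the set sought is its complement
    within the frontier, the space of \<mu>.\<close>
  also have "\<dots> = {\<phi> \<in> L2 \<mu>. AE x in \<mu>. x \<in> frontier \<Omega> - C \<longrightarrow> \<phi> x = 0}"
    unfolding eq by (auto simp: space_\<mu> cong: AE_cong)
  finally show ?thesis
    using C by (intro exI[of _ "frontier \<Omega> - C"]) (auto simp: sets_\<mu>_iff borel_closed)
qed

end


subsection \<open>Sectorial coefficients\<close>

text \<open>In polar form Re z = r cos \<alpha>, and the cosine is even and decreasing on [0, pi],
  so cos \<alpha> is at least cos \<theta>, which is positive.\<close>

lemma sector_bound:
  assumes "z \<in> sector \<theta>" "0 \<le> \<theta>" "\<theta> < pi / 2"
  shows "cmod z \<le> inverse (cos \<theta>) * Re z"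
proof -
  obtain r \<alpha> where z: "z = rcis r \<alpha>" "0 \<le> r" "\<bar>\<alpha>\<bar> \<le> \<theta>"
    using assms(1) by (auto simp: sector_def)
  have "0 < cos \<theta>" using assms by (intro cos_gt_zero_pi) auto
  have "cos \<theta> \<le> cos \<bar>\<alpha>\<bar>" using z(3) assms by (intro cos_monotone_0_pi_le) auto
  then have "r * cos \<theta> \<le> r * cos \<alpha>" using z(2) by (simp add: mult_left_mono)
  then show ?thesis using z(1,2) \<open>0 < cos \<theta>\<close> by (simp add: field_simps)
qed

text \<open>The exceptional null set of the hypothesis depends on \<xi>. A countable dense set of
  vectors has a common one; outside it, the inequality of \<open>sector_bound\<close> extends to all
  vectors, since at a fixed point it defines a closed set of \<xi>.\<close>

lemma AE_sectorial:
  fixes A :: "'d::finite \<Rightarrow> 'd \<Rightarrow> 'x \<Rightarrow> complex"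
  assumes \<theta>: "0 \<le> \<theta>" "\<theta> < pi / 2"
    and sector: "\<And>\<xi> :: complex^'d. AE x in M.
      (\<Sum>i\<in>UNIV. \<Sum>j\<in>UNIV. A i j x * \<xi> $ i * cnj (\<xi> $ j)) \<in> sector \<theta>"
  shows "AE x in M. \<forall>\<xi> :: 'd \<Rightarrow> complex.
    cmod (\<Sum>i\<in>UNIV. \<Sum>j\<in>UNIV. \<xi> i * A i j x * cnj (\<xi> j))
      \<le> inverse (cos \<theta>) * Re (\<Sum>i\<in>UNIV. \<Sum>j\<in>UNIV. \<xi> i * A i j x * cnj (\<xi> j))"
proof -
  define q where "q x \<xi> = (\<Sum>i\<in>UNIV. \<Sum>j\<in>UNIV. A i j x * \<xi> $ i * cnj (\<xi> $ j))"
    for x and \<xi> :: "complex^'d"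
  obtain D :: "(complex^'d) set" where D: "countable D"
      "\<And>X. open X \<Longrightarrow> X \<noteq> {} \<Longrightarrow> \<exists>d\<in>D. d \<in> X"
    using countable_dense_exists by blast
  have "AE x in M. \<forall>\<xi>\<in>D. q x \<xi> \<in> sector \<theta>"
    unfolding AE_ball_countable[OF D(1)] q_def using sector by blast
  then show ?thesis
  proof eventually_elim
    case (elim x)
    have cont: "continuous_on UNIV (q x)"
      unfolding q_def[abs_def] by (intro continuous_intros)
    have "closed {\<xi>. cmod (q x \<xi>) \<le> inverse (cos \<theta>) * Re (q x \<xi>)}"
      using cont by (intro closed_Collect_le continuous_intros)
    then have "open (- {\<xi>. cmod (q x \<xi>) \<le> inverse (cos \<theta>) * Re (q x \<xi>)})" by (rule open_Compl)
    \<comment> \<open>An open set that misses the dense set \<open>D\<close> is empty.\<close>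
    then have all: "cmod (q x \<xi>) \<le> inverse (cos \<theta>) * Re (q x \<xi>)" for \<xi>
      using D(2) elim sector_bound[OF _ \<theta>] by blast
    show ?case
    proof
      fix \<xi> :: "'d \<Rightarrow> complex"
      have "q x (\<chi> i. \<xi> i) = (\<Sum>i\<in>UNIV. \<Sum>j\<in>UNIV. \<xi> i * A i j x * cnj (\<xi> j))"
        by (simp add: q_def mult_ac)
      then show "cmod (\<Sum>i\<in>UNIV. \<Sum>j\<in>UNIV. \<xi> i * A i j x * cnj (\<xi> j))
          \<le> inverse (cos \<theta>) * Re (\<Sum>i\<in>UNIV. \<Sum>j\<in>UNIV. \<xi> i * A i j x * cnj (\<xi> j))"
        using all[of "\<chi> i. \<xi> i"] by (simp only:)
    qed
  qed
qed

theorem lemma4p14: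
  fixes \<Omega> :: "(real^'d) set"
    and A :: "'d \<Rightarrow> 'd \<Rightarrow> real^'d \<Rightarrow> complex"
    and \<theta> :: real
    and \<mu> :: "(real^'d) measure"
  assumes "open \<Omega>"
    and "\<And>i j. A i j \<in> L_infinity (lebesgue_on \<Omega>)"
    and "0 \<le> \<theta>" and "\<theta> < pi / 2"
    and "\<And>\<xi> :: complex^'d. AE x in lebesgue_on \<Omega>.
           (\<Sum>i\<in>UNIV. \<Sum>j\<in>UNIV. A i j x * \<xi> $ i * cnj (\<xi> $ j)) \<in> sector \<theta>"
    and "sets \<mu> = sets (restrict_space borel (frontier \<Omega>))"
    and "\<And>K. compact K \<Longrightarrow> K \<subseteq> frontier \<Omega> \<Longrightarrow> emeasure \<mu> K < \<infinity>"
    and "closable (lebesgue_on \<Omega>) (neumann_form \<Omega> A)"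
  shows "\<exists>\<Gamma>a. \<Gamma>a \<in> sets borel \<and> \<Gamma>a \<subseteq> frontier \<Omega> \<and>
           {\<phi> \<in> L2 \<mu>. is_trace \<Omega> A \<mu> \<phi> (\<lambda>x. 0)} =
           {\<phi> \<in> L2 \<mu>. AE x in \<mu>. x \<in> \<Gamma>a \<longrightarrow> \<phi> x = 0}"
proof -
  have "0 < cos \<theta>" using assms(3,4) by (intro cos_gt_zero_pi) auto
  then interpret robin \<Omega> A "inverse (cos \<theta>)" \<mu>
    using assms AE_sectorial[OF assms(3,4,5)] by unfold_locales auto
  show ?thesis by (rule zero_traces_eq)
qed

end
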